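(* Let $p$ be an odd prime, let $G$ be a finite $p$-stable group, and let $P\in \mathrm{Syl}_p(G)$. Suppose that $C_G(O_p(G))\leq O_p(G)$ and that $D$ is a strongly closed subgroup in $P$ (with respect to $G$). If the exponent of $\Omega(D)$ is $p$, then $Z(J_o(\Omega(D)))$, $Z(J_r(\Omega(D)))$ and $Z(J_e(\Omega(D)))$ are normal subgroups of $G$.
   Context: All groups are finite. Conjugation: $U^g=g^{-1}Ug$. $p$-stable: a group $G$ is $p$-stable if whenever $Q$ is a $p$-subgroup of $G$, $g\in N_G(Q)$ and $[Q,g,g]=1$ (where $[Q,g,g]=[[Q,g],g]$), the coset $gC_G(Q)$ lies in $O_p(N_G(Q)/C_G(Q))$. Strongly closed: a nonempty subset (in particular a subgroup) $D$ of $P$ is strongly closed in $P$ with respect to $G$ if for all $U\subseteq D$ and $g\in G$ with $U^g\subseteq P$ one has $U^g\subseteq D$. Thompson subgroups: for a $p$-group $X$, let $d_r(X)$ be the maximal rank (minimal number of generators) of an abelian subgroup of $X$, $d_o(X)$ the maximal order of an abelian subgroup of $X$, and $d_e(X)$ the maximal order of an elementary abelian subgroup of $X$. Let $\mathcal A_r(X)$ be the set of abelian subgroups of $X$ of rank $d_r(X)$, $\mathcal A_o(X)$ the set of abelian subgroups of order $d_o(X)$, and $\mathcal A_e(X)$ the set of elementary abelian subgroups of order $d_e(X)$. For $x\in\{r,o,e\}$, $J_x(X)$ is the subgroup of $X$ generated by all members of $\mathcal A_x(X)$. For a $p$-group $X$, $\Omega(X)=\langle\{y\in X\mid y^p=1\}\rangle$,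 and $Z(X)$ is the center of $X$. *)

theory Defs
  imports "HOL-Algebra.Sylow" "HOL-Algebra.Zassenhaus" "HOL-Algebra.Generated_Groups"
begin

text \<open>
  Subgroups are represented by their carrier sets inside an ambient group \<open>G\<close>. Notions that belong
  to a subgroup \<open>H\<close> alone (its center, Thompson subgroups, \<open>\<Omega>\<close>, \<open>\<dots>\<close>) take both \<open>G\<close> and the set
  \<open>H\<close>; only the operations of \<open>G\<close> restricted to \<open>H\<close> matter.
\<close>

definition p_subgroup :: "nat \<Rightarrow> 'a set \<Rightarrow> ('a, 'b) monoid_scheme \<Rightarrow> bool" where
  "p_subgroup p Q G \<longleftrightarrow> subgroup Q G \<and> (\<exists>n. card Q = p ^ n)"

definition sylow_subgroup :: "nat \<Rightarrow> 'a set \<Rightarrow> ('a, 'b) monoid_scheme \<Rightarrow> bool" where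
  "sylow_subgroup p P G \<longleftrightarrow> subgroup P G \<and> card P = p ^ multiplicity p (order G)"

text \<open>\<open>O\<^sub>p(G)\<close>, the largest normal \<open>p\<close>-subgroup: for finite \<open>G\<close> it is the subgroup generated by all
  normal \<open>p\<close>-subgroups.\<close>

definition p_core :: "nat \<Rightarrow> ('a, 'b) monoid_scheme \<Rightarrow> 'a set" where
  "p_core p G = generate G (\<Union> {N. N \<lhd> G \<and> p_subgroup p N G})"

definition centralizer :: "('a, 'b) monoid_scheme \<Rightarrow> 'a set \<Rightarrow> 'a set" where
  "centralizer G Q = {g \<in> carrier G. \<forall>x \<in> Q. g \<otimes>\<^bsub>G\<^esub> x = x \<otimes>\<^bsub>G\<^esub> g}"

definition center_of :: "('a, 'b) monoid_scheme \<Rightarrow> 'a set \<Rightarrow> 'a set" where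
  "center_of G H = {z \<in> H. \<forall>x \<in> H. z \<otimes>\<^bsub>G\<^esub> x = x \<otimes>\<^bsub>G\<^esub> z}"

definition commutator :: "('a, 'b) monoid_scheme \<Rightarrow> 'a \<Rightarrow> 'a \<Rightarrow> 'a" where
  "commutator G x g = inv\<^bsub>G\<^esub> x \<otimes>\<^bsub>G\<^esub> inv\<^bsub>G\<^esub> g \<otimes>\<^bsub>G\<^esub> x \<otimes>\<^bsub>G\<^esub> g"

text \<open>The subgroup \<open>[Q, g] = \<langle>[x, g] | x \<in> Q\<rangle>\<close>.\<close>

definition commutator_subgroup :: "('a, 'b) monoid_scheme \<Rightarrow> 'a set \<Rightarrow> 'a \<Rightarrow> 'a set" where
  "commutator_subgroup G Q g = generate G ((\<lambda>x. commutator G x g) ` Q)"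

text \<open>As \<open>C\<^sub>G(Q)\<close> is normal in \<open>N\<^sub>G(Q)\<close>, the left coset \<open>g C\<^sub>G(Q)\<close> is also a right coset, and hence an
  element of the quotient as formed by \<open>Mod\<close>.\<close>

definition p_stable :: "nat \<Rightarrow> ('a, 'b) monoid_scheme \<Rightarrow> bool" where
  "p_stable p G \<longleftrightarrow>
     (\<forall>Q g. p_subgroup p Q G \<longrightarrow> g \<in> normalizer G Q \<longrightarrow>
        commutator_subgroup G (commutator_subgroup G Q g) g = {\<one>\<^bsub>G\<^esub>} \<longrightarrow>
        g <#\<^bsub>G\<^esub> centralizer G Q
          \<in> p_core p (G\<lparr>carrier := normalizer G Q\<rparr> Mod centralizer G Q))"

definition strongly_closed :: "'a set \<Rightarrow> 'a set \<Rightarrow> ('a, 'b) monoid_scheme \<Rightarrow> bool" where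
  "strongly_closed D P G \<longleftrightarrow> D \<noteq> {} \<and> D \<subseteq> P \<and>
     (\<forall>U g. U \<subseteq> D \<longrightarrow> g \<in> carrier G \<longrightarrow>
        inv\<^bsub>G\<^esub> g <#\<^bsub>G\<^esub> U #>\<^bsub>G\<^esub> g \<subseteq> P \<longrightarrow> inv\<^bsub>G\<^esub> g <#\<^bsub>G\<^esub> U #>\<^bsub>G\<^esub> g \<subseteq> D)"

definition Omega :: "nat \<Rightarrow> ('a, 'b) monoid_scheme \<Rightarrow> 'a set \<Rightarrow> 'a set" where
  "Omega p G H = generate G {y \<in> H. y [^]\<^bsub>G\<^esub> p = \<one>\<^bsub>G\<^esub>}"

definition exponent_of :: "('a, 'b) monoid_scheme \<Rightarrow> 'a set \<Rightarrow> nat" where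
  "exponent_of G H = (LEAST n. n > 0 \<and> (\<forall>x \<in> H. x [^]\<^bsub>G\<^esub> n = \<one>\<^bsub>G\<^esub>))"

definition rank_of :: "('a, 'b) monoid_scheme \<Rightarrow> 'a set \<Rightarrow> nat" where
  "rank_of G A = (LEAST n. \<exists>S. S \<subseteq> A \<and> finite S \<and> card S = n \<and> generate G S = A)"

definition abelian_subgroups :: "('a, 'b) monoid_scheme \<Rightarrow> 'a set \<Rightarrow> 'a set set" where
  "abelian_subgroups G H = {A. subgroup A G \<and> A \<subseteq> H \<and> comm_group (G\<lparr>carrier := A\<rparr>)}"

definition elementary_abelian_subgroups ::
    "nat \<Rightarrow> ('a, 'b) monoid_scheme \<Rightarrow> 'a set \<Rightarrow> 'a set set" where
  "elementary_abelian_subgroups p G H =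
     {A \<in> abelian_subgroups G H. \<forall>x \<in> A. x [^]\<^bsub>G\<^esub> p = \<one>\<^bsub>G\<^esub>}"

definition d_r :: "('a, 'b) monoid_scheme \<Rightarrow> 'a set \<Rightarrow> nat" where
  "d_r G H = Max (rank_of G ` abelian_subgroups G H)"

definition d_o :: "('a, 'b) monoid_scheme \<Rightarrow> 'a set \<Rightarrow> nat" where
  "d_o G H = Max (card ` abelian_subgroups G H)"

definition d_e :: "nat \<Rightarrow> ('a, 'b) monoid_scheme \<Rightarrow> 'a set \<Rightarrow> nat" where
  "d_e p G H = Max (card ` elementary_abelian_subgroups p G H)"

definition J_r :: "('a, 'b) monoid_scheme \<Rightarrow> 'a set \<Rightarrow> 'a set" where
  "J_r G H = generate G (\<Union> {A \<in> abelian_subgroups G H. rank_of G A = d_r G H})"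

definition J_o :: "('a, 'b) monoid_scheme \<Rightarrow> 'a set \<Rightarrow> 'a set" where
  "J_o G H = generate G (\<Union> {A \<in> abelian_subgroups G H. card A = d_o G H})"

definition J_e :: "nat \<Rightarrow> ('a, 'b) monoid_scheme \<Rightarrow> 'a set \<Rightarrow> 'a set" where
  "J_e p G H =
     generate G (\<Union> {A \<in> elementary_abelian_subgroups p G H. card A = d_e p G H})"

end

theory Submission
  imports Defs "HOL-Algebra.Multiplicative_Group"
begin

text \<open>Let \<open>E = \<Omega>(D)\<close>. As \<open>E\<close> has exponent \<open>p\<close>, it consists of elements of order dividing \<open>p\<close>, so it
inherits strong closure from \<open>D\<close>; moreover every abelian subgroup \<open>A\<close> of \<open>E\<close> is elementary of order
\<open>p\<close> to the rank of \<open>A\<close>. Rank and order therefore select the same abelian subgroups, the three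
Thompson subgroups of \<open>E\<close> are one group \<open>J\<close> (\<open>thompson_subgroups_coincide\<close>), and it remains to
show that \<open>Z = Z(J)\<close> is normal in \<open>G\<close>.

The core of the argument, which is Glauberman's proof of the ZJ-theorem carried out inside \<open>E\<close>, is
\<open>normal_meets_center_J_o\<close>: \<open>B \<inter> Z\<close> is normal in \<open>G\<close> for each normal subgroup \<open>B\<close> of \<open>G\<close> contained
in \<open>E\<close>. By induction on the order of \<open>B\<close> one may assume that the \<open>G\<close>-conjugates of \<open>B \<inter> Z\<close>
generate \<open>B\<close>. The induction hypothesis for \<open>[B,B]\<close> then gives \<open>[B,B] \<le> Z \<inter> Z(B)\<close>. Put
\<open>C = C\<^sub>G(B)\<close> and let \<open>L\<close> be the preimage of \<open>O\<^sub>p(G/C)\<close>. If \<open>B\<close> normalizes an abelian subgroup \<open>A\<close>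
of \<open>E\<close>, then \<open>[B,A,A] = 1\<close>, and \<open>A \<le> L\<close> by \<open>p\<close>-stability. Glauberman's replacement theorem
(\<open>glauberman_replacement\<close>) turns an abelian \<open>A\<close> of maximal order which \<open>B\<close> does not normalize into
another one, normalizing \<open>A\<close>, that meets \<open>B\<close> in a larger subgroup; hence some \<open>A\<close> lies in \<open>L\<close>. The
Frattini argument for the Sylow subgroup \<open>T = P \<inter> L\<close> of \<open>L\<close> gives \<open>G = N\<^sub>G(T) C\<close>. By strong
closure \<open>N\<^sub>G(T)\<close> normalizes \<open>E \<inter> L\<close>, so it normalizes \<open>Z\<^sub>1 = Z(J(E \<inter> L))\<close>, which contains \<open>Z\<close>;
therefore \<open>Z\<^sub>1\<close> contains all conjugates of \<open>B \<inter> Z\<close>, and \<open>B \<le> Z\<^sub>1\<close>. If every abelian subgroup of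
maximal order lies in \<open>L\<close>, then \<open>Z\<^sub>1 = Z\<close> and \<open>B \<le> Z\<close>. Otherwise a second replacement yields a
contradiction.

Finally, \<open>Z\<close> is an abelian normal subgroup of \<open>P\<close>, so \<open>[O\<^sub>p(G),Z,Z] = 1\<close>, and \<open>p\<close>-stability together
with \<open>C\<^sub>G(O\<^sub>p(G)) \<le> O\<^sub>p(G)\<close> forces \<open>Z \<le> O\<^sub>p(G)\<close>. By strong closure \<open>B = O\<^sub>p(G) \<inter> E\<close> is normal in
\<open>G\<close>, and \<open>Z = B \<inter> Z\<close> (\<open>center_J_o_normal\<close>).\<close>

section \<open>Fixed points of p-groups and Sylow theory\<close>

lemma (in group) cancel_inv_left:
  assumes "x \<in> carrier G" "y \<in> carrier G"
  shows "inv x \<otimes> (x \<otimes> y) = y" and "x \<otimes> (inv x \<otimes> y) = y"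
  using assms by (simp_all add: m_assoc[symmetric])

text \<open>These rules bring words in group elements and their inverses into reduced form, so that the
simplifier decides identities of free groups.\<close>

lemmas (in group) word_simps = m_assoc inv_mult_group cancel_inv_left

lemma (in group) conj_hom:
  assumes "g \<in> carrier G"
  shows "group_hom G G (\<lambda>x. g \<otimes> x \<otimes> inv g)"
  using assms by unfold_locales (auto intro!: homI simp: word_simps)

text \<open>Orbits of a \<open>p\<close>-group have \<open>p\<close>-power length, so an orbit with more than one point contributes \<open>0\<close>
modulo \<open>p\<close>.\<close>

lemma (in group_action) card_fixed_points_mod:
  assumes p: "Factorial_Ring.prime p" and "order G = p ^ n" and fin: "finite E"
  shows "card E mod p = card {x \<in> E. \<forall>g \<in> carrier G. \<phi> g x = x} mod p"
proof -
  interpret G: group G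
    using group_hom group_hom.axioms(1) by blast
  define F where "F = {x \<in> E. \<forall>g \<in> carrier G. \<phi> g x = x}"
  have F_iff: "x \<in> F \<longleftrightarrow> orbit G \<phi> x = {x}" if "x \<in> E" for x
    using that orbit_refl[OF that] by (auto simp: F_def orbit_def)
  have orb_sub: "orb \<subseteq> E" if "orb \<in> orbits G E \<phi>" for orb
    using that orbits_coverture by blast
  have card_orb: "card orb mod p = card (orb \<inter> F) mod p" if orb: "orb \<in> orbits G E \<phi>" for orb
  proof -
    obtain x where x: "x \<in> E" "orb = orbit G \<phi> x"
      using orb by (auto simp: orbits_def)
    show ?thesis
    proof (cases "x \<in> F")
      case True
      then show ?thesis using x F_iff by simp
    next
      case False
      have "orb \<inter> F = {}"
      proof (rule ccontr)
        assume "orb \<inter> F \<noteq> {}"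
        then obtain y where y: "y \<in> orb" "y \<in> F" by blast
        have "y \<in> E" using y by (simp add: F_def)
        then have "x \<in> orbit G \<phi> y" using orbit_sym x y by blast
        then show False using F_iff \<open>y \<in> E\<close> y False by auto
      qed
      moreover have "p dvd card orb"
      proof -
        have "card orb dvd p ^ n"
          using orbit_stabilizer_theorem[OF x(1)] assms(2) x(2) by (metis dvd_triv_left)
        then obtain k where k: "card orb = p ^ k"
          using p by (auto simp: divides_primepow_nat)
        have "k \<noteq> 0"
        proof
          assume "k = 0"
          then obtain z where "orb = {z}" using k by (auto simp: card_1_singleton_iff)
          moreover have "x \<in> orb" using x orbit_refl by simp
          ultimately show False using False F_iff x by auto
        qed
        then show ?thesis using k by simp
      qed
      ultimately show ?thesis by simp
    qed
  qed
  have fin_orbits: "finite (orbits G E \<phi>)"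
    using fin orb_sub by (meson PowI finite_Pow_iff finite_subset subsetI)
  have "(\<Sum>orb\<in>orbits G E \<phi>. card orb) mod p = (\<Sum>orb\<in>orbits G E \<phi>. card (orb \<inter> F)) mod p"
    using card_orb by (subst (1 2) mod_sum_eq[symmetric]) simp
  moreover have "(\<Sum>orb\<in>orbits G E \<phi>. card (orb \<inter> F')) = card (E \<inter> F')" for F'
  proof -
    have "(\<Sum>orb\<in>orbits G E \<phi>. card (orb \<inter> F'))
        = (\<Sum>orb\<in>orbits G E \<phi>. \<Sum>x\<in>orb. if x \<in> F' then 1 else 0)"
      by (rule sum.cong[OF refl]) (simp add: sum.If_cases finite_subset[OF orb_sub fin])
    also have "\<dots> = card (E \<inter> F')"
      using fin by (simp add: disjoint_sum sum.If_cases)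
    finally show ?thesis .
  qed
  from this[of UNIV] this[of F] have "(\<Sum>orb\<in>orbits G E \<phi>. card orb) = card E"
     "(\<Sum>orb\<in>orbits G E \<phi>. card (orb \<inter> F)) = card F"
    by (simp_all add: F_def Int_absorb1)
  ultimately show ?thesis by (simp add: F_def)
qed

text \<open>The count of fixed points, for the action of \<open>q \<in> Q\<close> on right cosets by \<open>C \<mapsto> C (inv q)\<close>.\<close>

lemma (in group) card_fixed_cosets_mod:
  assumes p: "Factorial_Ring.prime p" and fin: "finite (carrier G)"
    and S: "subgroup S G" and Q: "p_subgroup p Q G"
  shows "card (rcosets S) mod p = card {C \<in> rcosets S. \<forall>q \<in> Q. C #> q = C} mod p"
proof -
  define \<phi> where "\<phi> = (\<lambda>q. \<lambda>C \<in> rcosets S. C #> inv q)"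
  have QG: "subgroup Q G" using Q by (simp add: p_subgroup_def)
  have Qc: "q \<in> carrier G" if "q \<in> Q" for q using QG that by (rule subgroup.mem_carrier)
  have Sc: "C \<subseteq> carrier G" if "C \<in> rcosets S" for C
    using S that by (rule subgroup.rcosets_carrier[OF _ is_group])
  have closed: "C #> g \<in> rcosets S" if "C \<in> rcosets S" "g \<in> carrier G" for C g
    using that subgroup.subset[OF S] by (auto simp: RCOSETS_def coset_mult_assoc)
  have inverse: "C #> g #> inv g = C" "C #> inv g #> g = C"
    if "C \<in> rcosets S" "g \<in> carrier G" for C g
    using that Sc by (simp_all add: coset_mult_assoc)
  have act: "group_action (G\<lparr>carrier := Q\<rparr>) (rcosets S) \<phi>"
    unfolding group_action_def group_hom_def group_hom_axioms_def
  proof (intro conjI)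
    show "group (G\<lparr>carrier := Q\<rparr>)" by (rule subgroup_imp_group[OF QG])
    show "group (BijGroup (rcosets S))" by (rule group_BijGroup)
    have bij: "\<phi> q \<in> Bij (rcosets S)" if "q \<in> Q" for q
      unfolding Bij_def
    proof (intro IntI CollectI)
      show "\<phi> q \<in> extensional (rcosets S)" by (simp add: \<phi>_def)
      show "bij_betw (\<phi> q) (rcosets S) (rcosets S)"
        by (rule bij_betw_byWitness[where f' = "\<lambda>C. C #> q"])
          (use that Qc closed inverse in \<open>auto simp: \<phi>_def\<close>)
    qed
    show "\<phi> \<in> hom (G\<lparr>carrier := Q\<rparr>) (BijGroup (rcosets S))"
    proof (rule homI)
      show "\<phi> q \<in> carrier (BijGroup (rcosets S))" if "q \<in> carrier (G\<lparr>carrier := Q\<rparr>)" for q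
        using that bij by (simp add: BijGroup_def)
      show "\<phi> (q \<otimes>\<^bsub>G\<lparr>carrier := Q\<rparr>\<^esub> r) = \<phi> q \<otimes>\<^bsub>BijGroup (rcosets S)\<^esub> \<phi> r"
        if "q \<in> carrier (G\<lparr>carrier := Q\<rparr>)" "r \<in> carrier (G\<lparr>carrier := Q\<rparr>)" for q r
      proof -
        have "\<phi> (q \<otimes> r) C = compose (rcosets S) (\<phi> q) (\<phi> r) C" for C
          using that Qc closed Sc
          by (auto simp: \<phi>_def compose_def coset_mult_assoc inv_mult_group)
        then show ?thesis using that bij by (auto simp: BijGroup_def)
      qed
    qed
  qed
  obtain n where n: "card Q = p ^ n" using Q by (auto simp: p_subgroup_def)
  have "finite (rcosets S)"
    using fin rcosets_part_G[OF S] by (metis finite_UnionD)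
  from group_action.card_fixed_points_mod[OF act p _ this] n
  have "card (rcosets S) mod p = card {C \<in> rcosets S. \<forall>q \<in> Q. \<phi> q C = C} mod p"
    by (simp add: order_def)
  moreover have "(\<forall>q \<in> Q. \<phi> q C = C) \<longleftrightarrow> (\<forall>q \<in> Q. C #> q = C)" if "C \<in> rcosets S" for C
    using that subgroup.m_inv_closed[OF QG] Qc by (simp add: \<phi>_def) (metis inv_inv)
  ultimately show ?thesis by (simp cong: conj_cong)
qed

lemma (in group) fixed_coset_conj_into:
  assumes S: "subgroup S G" and Q: "Q \<subseteq> carrier G" and g: "g \<in> carrier G"
    and fix_C: "\<forall>q \<in> Q. S #> g #> q = S #> g" and q: "q \<in> Q"
  shows "g \<otimes> q \<otimes> inv g \<in> S"
proof -
  have qc: "q \<in> carrier G" using Q q by blast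
  have "g \<otimes> q \<in> S #> g"
    using fix_C q qc g S rcos_self[of "g \<otimes> q" S] coset_mult_assoc[OF subgroup.subset[OF S] g qc]
    by auto
  then obtain s where s: "s \<in> S" "g \<otimes> q = s \<otimes> g" by (auto simp: r_coset_def)
  then have "g \<otimes> q \<otimes> inv g = s"
    using g subgroup.mem_carrier[OF S] by (simp add: m_assoc)
  then show ?thesis using s by simp
qed

text \<open>When \<open>p\<close> does not divide the number of cosets, some coset \<open>S g\<close> is fixed by \<open>Q\<close>, which means that
\<open>g\<close> conjugates \<open>Q\<close> into \<open>S\<close>.\<close>

lemma (in group) p_subgroup_conj_into:
  assumes "Factorial_Ring.prime p" and "finite (carrier G)" and S: "subgroup S G"
    and Q: "p_subgroup p Q G" and "\<not> p dvd card (rcosets S)"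
  shows "\<exists>g \<in> carrier G. \<forall>q \<in> Q. g \<otimes> q \<otimes> inv g \<in> S"
proof -
  have "{C \<in> rcosets S. \<forall>q \<in> Q. C #> q = C} \<noteq> {}"
    using card_fixed_cosets_mod[OF assms(1-4)] assms(5) by (metis card.empty mod_0 mod_eq_0_iff_dvd)
  then obtain g where "g \<in> carrier G" "\<forall>q \<in> Q. S #> g #> q = S #> g"
    by (auto simp: RCOSETS_def)
  then show ?thesis
    using fixed_coset_conj_into[OF S] Q by (meson p_subgroup_def subgroup.subset)
qed

text \<open>Here \<open>S\<close> is itself a fixed coset, and as \<open>p\<close> divides the number of fixed cosets there is another.\<close>

lemma (in group) p_subgroup_conj_into_outside:
  assumes "Factorial_Ring.prime p" and fin: "finite (carrier G)" and S: "subgroup S G"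
    and Q: "p_subgroup p Q G" and "p dvd card (rcosets S)" and "Q \<subseteq> S"
  shows "\<exists>g \<in> carrier G - S. \<forall>q \<in> Q. g \<otimes> q \<otimes> inv g \<in> S"
proof -
  let ?F = "{C \<in> rcosets S. \<forall>q \<in> Q. C #> q = C}"
  have "p dvd card ?F"
    using card_fixed_cosets_mod[OF assms(1-4)] assms(5) unfolding dvd_eq_mod_eq_0 by (rule trans[OF sym])
  have "S \<in> ?F"
    using subgroup.subgroup_in_rcosets[OF S is_group] \<open>Q \<subseteq> S\<close> subgroup.rcos_const[OF S is_group]
    by blast
  have "p > 1" using assms(1) by (rule prime_gt_1_nat)
  have "?F \<noteq> {S}"
  proof
    assume "?F = {S}"
    then have "p dvd card {S}" using \<open>p dvd card ?F\<close> by (rule subst)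
    then show False using \<open>p > 1\<close> by simp
  qed
  then obtain C where C: "C \<in> ?F" "C \<noteq> S" using \<open>S \<in> ?F\<close> by blast
  then obtain g where g: "g \<in> carrier G" "C = S #> g" by (auto simp: RCOSETS_def)
  then have "g \<notin> S" using C subgroup.rcos_const[OF S is_group] by blast
  moreover have "\<forall>q \<in> Q. g \<otimes> q \<otimes> inv g \<in> S"
    using fixed_coset_conj_into[OF S _ g(1)] C g Q by (auto simp: p_subgroup_def dest: subgroup.subset)
  ultimately show ?thesis using g by blast
qed

lemma (in group) card_subgroup_dvd:
  assumes "subgroup H G" "subgroup K G" "H \<subseteq> K"
  shows "card H dvd card K"
proof -
  have "card (rcosets\<^bsub>G\<lparr>carrier := K\<rparr>\<^esub> H) * card H = card K"
    using group.lagrange[OF subgroup_imp_group[OF assms(2)] subgroup_incl[OF assms]]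
    by (simp add: order_def)
  then show ?thesis by (metis dvd_triv_right)
qed

lemma (in group) p_subgroup_mono:
  assumes p: "Factorial_Ring.prime p" and "p_subgroup p Q G" "subgroup H G" "H \<subseteq> Q"
  shows "p_subgroup p H G"
  using assms card_subgroup_dvd[of H Q] divides_primepow_nat[OF p]
  unfolding p_subgroup_def by metis

lemma (in group) p_subgroup_restrict_iff:
  assumes "subgroup H G"
  shows "p_subgroup p Q (G\<lparr>carrier := H\<rparr>) \<longleftrightarrow> p_subgroup p Q G \<and> Q \<subseteq> H"
  using assms incl_subgroup[OF assms, of Q] subgroup_incl[of Q H] subgroup.subset[of Q "G\<lparr>carrier := H\<rparr>"]
  by (auto simp: p_subgroup_def)

lemma (in group) p_subgroup_normalizer_grows:
  assumes p: "Factorial_Ring.prime p" and fin: "finite (carrier G)"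
    and X: "p_subgroup p X G" and H: "subgroup H G" "H \<subset> X"
  shows "\<exists>x \<in> X - H. \<forall>h \<in> H. x \<otimes> h \<otimes> inv x \<in> H"
proof -
  let ?X = "G\<lparr>carrier := X\<rparr>"
  have XG: "subgroup X G" and "finite X"
    using X fin by (auto simp: p_subgroup_def dest: subgroup.subset finite_subset)
  interpret X: group ?X by (rule subgroup_imp_group[OF XG])
  have HX: "subgroup H ?X" using H by (intro subgroup_incl[OF _ XG]) auto
  have pH: "p_subgroup p H G" using p_subgroup_mono[OF p X H(1)] H(2) by blast
  have "card H < card X" using H \<open>finite X\<close> by (intro psubset_card_mono)
  have index: "card (rcosets\<^bsub>?X\<^esub> H) * card H = card X"
    using X.lagrange[OF HX] by (simp add: order_def)
  obtain n where "card X = p ^ n" using X by (auto simp: p_subgroup_def)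
  then have "card (rcosets\<^bsub>?X\<^esub> H) dvd p ^ n" using index by (metis dvd_triv_left)
  then obtain k where k: "card (rcosets\<^bsub>?X\<^esub> H) = p ^ k"
    using divides_primepow_nat[OF p] by blast
  have "k \<noteq> 0"
    using k index \<open>card H < card X\<close> by (auto intro: ccontr)
  then have "p dvd card (rcosets\<^bsub>?X\<^esub> H)" using k by simp
  then obtain x where "x \<in> X - H" "\<forall>h \<in> H. x \<otimes> h \<otimes> inv\<^bsub>?X\<^esub> x \<in> H"
    using X.p_subgroup_conj_into_outside[OF p _ HX, of H] \<open>finite X\<close> pH H p_subgroup_restrict_iff[OF XG]
    by auto
  then show ?thesis using m_inv_consistent[OF XG] by auto
qed

lemma sylow_subgroup_exists:
  assumes "Factorial_Ring.prime p" and "group G" and "finite (carrier G)"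
  shows "\<exists>S. sylow_subgroup p S G"
proof -
  obtain m where "order G = p ^ multiplicity p (order G) * m"
    using multiplicity_dvd by (metis dvdE)
  then show ?thesis
    using sylow_thm[OF assms(1,2) _ assms(3)] by (auto simp: sylow_subgroup_def)
qed

text \<open>Coprimality of the index to \<open>p\<close> is the form in which the Sylow property meets the count of fixed
cosets.\<close>

lemma (in group) sylow_subgroup_iff:
  assumes p: "Factorial_Ring.prime p" and fin: "finite (carrier G)"
  shows "sylow_subgroup p S G \<longleftrightarrow> p_subgroup p S G \<and> \<not> p dvd card (rcosets S)"
proof (cases "subgroup S G")
  case True
  have ord: "order G \<noteq> 0" using fin order_gt_0_iff_finite by simp
  have "\<not> is_unit p" using p not_prime_unit by blast
  have lag: "card (rcosets S) * card S = order G" by (rule lagrange[OF True])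
  have "card S = p ^ multiplicity p (order G) \<longleftrightarrow>
      (\<exists>n. card S = p ^ n) \<and> \<not> p dvd card (rcosets S)" (is "?l = ?r")
  proof
    assume l: ?l
    have "\<not> p dvd card (rcosets S)"
    proof
      assume "p dvd card (rcosets S)"
      then have "p * card S dvd order G" using lag by (metis dvd_refl mult_dvd_mono)
      then have "p ^ Suc (multiplicity p (order G)) dvd order G" using l by simp
      then show False
        using power_dvd_iff_le_multiplicity[OF ord \<open>\<not> is_unit p\<close>] by (metis Suc_n_not_le_n)
    qed
    with l show ?r by blast
  next
    assume r: ?r
    then obtain n where n: "card S = p ^ n" by blast
    have "multiplicity p (order G) = multiplicity p (card (rcosets S)) + multiplicity p (card S)"
      using p ord by (subst lag[symmetric], intro prime_elem_multiplicity_mult_distrib)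
        (auto simp flip: lag)
    also have "\<dots> = n"
      using r n p by (simp add: not_dvd_imp_multiplicity_0)
    finally show ?l using n by simp
  qed
  then show ?thesis using True by (auto simp: sylow_subgroup_def p_subgroup_def)
qed (simp add: sylow_subgroup_def p_subgroup_def)

lemma (in group) p_subgroup_conj_into_sylow:
  assumes p: "Factorial_Ring.prime p" and fin: "finite (carrier G)"
    and S: "sylow_subgroup p S G" and Q: "p_subgroup p Q G"
  shows "\<exists>g \<in> carrier G. \<forall>q \<in> Q. g \<otimes> q \<otimes> inv g \<in> S"
proof -
  have "subgroup S G" "\<not> p dvd card (rcosets S)"
    using S sylow_subgroup_iff[OF p fin] p_subgroup_def by metis+
  then show ?thesis by (rule p_subgroup_conj_into[OF p fin _ Q])
qed

text \<open>Some conjugate of \<open>Q\<close> lies in \<open>S\<close>, and \<open>Q\<close> is its only conjugate.\<close>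

lemma (in group) normal_p_subgroup_in_sylow:
  assumes p: "Factorial_Ring.prime p" and fin: "finite (carrier G)"
    and S: "sylow_subgroup p S G" and Q: "p_subgroup p Q G" "Q \<lhd> G"
  shows "Q \<subseteq> S"
proof
  fix q assume q: "q \<in> Q"
  obtain g where g: "g \<in> carrier G" "\<forall>q \<in> Q. g \<otimes> q \<otimes> inv g \<in> S"
    using p_subgroup_conj_into_sylow[OF p fin S Q(1)] by blast
  have qc: "q \<in> carrier G" using Q q by (auto simp: p_subgroup_def dest: subgroup.mem_carrier)
  have "inv g \<otimes> q \<otimes> g \<in> Q"
    using normal.inv_op_closed1[OF Q(2) g(1) q] .
  then have "g \<otimes> (inv g \<otimes> q \<otimes> g) \<otimes> inv g \<in> S" using g by blast
  then show "q \<in> S" using g(1) qc by (simp add: word_simps)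
qed

lemma (in group) p_core_normal:
  "p_core p G \<lhd> G"
  unfolding p_core_def
proof (rule normal_generateI)
  show "\<Union> {N. N \<lhd> G \<and> p_subgroup p N G} \<subseteq> carrier G"
    using subgroup.subset by (fastforce simp: p_subgroup_def)
  show "g \<otimes> h \<otimes> inv g \<in> \<Union> {N. N \<lhd> G \<and> p_subgroup p N G}"
    if "h \<in> \<Union> {N. N \<lhd> G \<and> p_subgroup p N G}" "g \<in> carrier G" for h g
  proof -
    from that(1) obtain N where "N \<lhd> G" "p_subgroup p N G" "h \<in> N" by blast
    then show ?thesis using normal.inv_op_closed2[of N G g h] that(2) by blast
  qed
qed

lemma (in group) p_core_subset_sylow:
  assumes p: "Factorial_Ring.prime p" and fin: "finite (carrier G)"
    and S: "sylow_subgroup p S G"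
  shows "p_core p G \<subseteq> S"
  unfolding p_core_def
  using S normal_p_subgroup_in_sylow[OF p fin S]
  by (intro generate_subgroup_incl) (auto simp: sylow_subgroup_def)

text \<open>The generators of \<open>O\<^sub>p(G)\<close> all lie in one Sylow subgroup.\<close>

lemma (in group) p_core_p_subgroup:
  assumes p: "Factorial_Ring.prime p" and fin: "finite (carrier G)"
  shows "p_subgroup p (p_core p G) G"
proof -
  obtain S where S: "sylow_subgroup p S G"
    using sylow_subgroup_exists[OF p is_group fin] by blast
  show ?thesis
    using p_subgroup_mono[OF p _ normal_imp_subgroup[OF p_core_normal] p_core_subset_sylow[OF p fin S]]
      S sylow_subgroup_iff[OF p fin] by blast
qed

lemma (in group) normal_p_subgroup_in_p_core:
  assumes "N \<lhd> G" "p_subgroup p N G"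
  shows "N \<subseteq> p_core p G"
  unfolding p_core_def using assms by (auto intro: generate.incl)

lemma (in group) conj_image_eq:
  assumes "finite T" "T \<subseteq> carrier G" "g \<in> carrier G" "\<forall>t \<in> T. g \<otimes> t \<otimes> inv g \<in> T"
  shows "(\<lambda>t. g \<otimes> t \<otimes> inv g) ` T = T"
proof (rule endo_inj_surj[OF assms(1)])
  show "inj_on (\<lambda>t. g \<otimes> t \<otimes> inv g) T"
    using assms(2,3) by (intro inj_onI) (simp add: subset_iff)
qed (use assms(4) in blast)

lemma (in group) conj_stabilizer_subgroup:
  assumes B: "subgroup B G" and M: "finite M" "M \<subseteq> carrier G"
  shows "subgroup {b \<in> B. \<forall>m\<in>M. b \<otimes> m \<otimes> inv b \<in> M} G" (is "subgroup ?N G")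
proof (rule subgroupI)
  have Bc: "b \<in> carrier G" if "b \<in> B" for b using B that by (rule subgroup.mem_carrier)
  have Mc: "b \<in> carrier G" if "b \<in> M" for b using M that by blast
  show "?N \<noteq> {}" using subgroup.one_closed[OF B] Mc by force
  show "?N \<subseteq> carrier G" using Bc by blast
  show "inv a \<in> ?N" if a: "a \<in> ?N" for a
  proof -
    have ac: "a \<in> carrier G" using a Bc by simp
    have "inv a \<otimes> m \<otimes> inv (inv a) \<in> M" if m: "m \<in> M" for m
    proof -
      have "(\<lambda>m. a \<otimes> m \<otimes> inv a) ` M = M"
        using a ac M by (intro conj_image_eq) auto
      then obtain m' where m': "m' \<in> M" "m = a \<otimes> m' \<otimes> inv a" using m by blast
      then show ?thesis using ac Mc[OF m'(1)] by (simp add: word_simps)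
    qed
    then show ?thesis using a subgroup.m_inv_closed[OF B] by simp
  qed
  show "a \<otimes> b \<in> ?N" if a: "a \<in> ?N" and b: "b \<in> ?N" for a b
  proof -
    have "(a \<otimes> b) \<otimes> m \<otimes> inv (a \<otimes> b) = a \<otimes> (b \<otimes> m \<otimes> inv b) \<otimes> inv a" if "m \<in> M" for m
      using a b Bc Mc[OF that] by (simp add: word_simps)
    then show ?thesis using a b subgroup.m_closed[OF B] by simp
  qed
qed

text \<open>A conjugate of a Sylow subgroup of \<open>L\<close> lies in \<open>P\<close>, and also in \<open>L\<close> by normality; so \<open>P \<inter> L\<close> is a
\<open>p\<close>-subgroup of \<open>L\<close> of at least Sylow order.\<close>

lemma (in group) sylow_of_normal_subgroup:
  assumes p: "Factorial_Ring.prime p" and fin: "finite (carrier G)"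
    and P: "sylow_subgroup p P G" and L: "L \<lhd> G"
  shows "sylow_subgroup p (P \<inter> L) (G\<lparr>carrier := L\<rparr>)"
proof -
  let ?L = "G\<lparr>carrier := L\<rparr>"
  have LG: "subgroup L G" by (rule normal_imp_subgroup[OF L])
  have PG: "subgroup P G" using P by (simp add: sylow_subgroup_def)
  interpret L: group ?L by (rule subgroup_imp_group[OF LG])
  have finL: "finite (carrier ?L)" using fin LG by (auto dest: subgroup.subset finite_subset)
  obtain S where S: "sylow_subgroup p S ?L"
    using sylow_subgroup_exists[OF p L.is_group finL] by blast
  have pS: "p_subgroup p S G" "S \<subseteq> L"
    using S L.sylow_subgroup_iff[OF p finL] p_subgroup_restrict_iff[OF LG] by blast+
  obtain g where g: "g \<in> carrier G" "\<forall>s \<in> S. g \<otimes> s \<otimes> inv g \<in> P"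
    using p_subgroup_conj_into_sylow[OF p fin P pS(1)] by blast
  have T: "subgroup (P \<inter> L) ?L"
    using subgroups_Inter_pair[OF PG LG] by (rule subgroup_incl[OF _ LG]) blast
  have pT: "p_subgroup p (P \<inter> L) G"
    using p_subgroup_mono[OF p _ subgroups_Inter_pair[OF PG LG]] P sylow_subgroup_iff[OF p fin] by blast
  have finT: "finite (P \<inter> L)" using finL by simp
  have "card S \<le> card (P \<inter> L)"
  proof (rule card_inj_on_le[OF _ _ finT])
    show "inj_on (\<lambda>s. g \<otimes> s \<otimes> inv g) S"
      using g(1) subgroup.mem_carrier[of S G] pS(1) by (intro inj_onI) (simp add: p_subgroup_def)
    show "(\<lambda>s. g \<otimes> s \<otimes> inv g) ` S \<subseteq> P \<inter> L"
      using g pS(2) normal.inv_op_closed2[OF L] by blast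
  qed
  moreover have "card (P \<inter> L) dvd p ^ multiplicity p (order ?L)"
  proof -
    obtain n where n: "card (P \<inter> L) = p ^ n" using pT by (auto simp: p_subgroup_def)
    have "p ^ n dvd order ?L" using L.lagrange[OF T] n by (metis dvd_triv_right)
    moreover have "order ?L \<noteq> 0" using finL L.order_gt_0_iff_finite by simp
    ultimately show ?thesis
      using n p by (metis le_imp_power_dvd multiplicity_geI not_prime_unit)
  qed
  ultimately have "card (P \<inter> L) = card S"
    using S p by (metis dvd_imp_le le_antisym prime_gt_0_nat sylow_subgroup_def zero_less_power)
  then show ?thesis using S T by (simp add: sylow_subgroup_def)
qed

text \<open>The conjugate of \<open>T\<close> by \<open>g\<close> is again a \<open>p\<close>-subgroup of \<open>L\<close>, so an element \<open>l\<close> of \<open>L\<close> moves it back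
into \<open>T\<close>.\<close>

lemma (in group) frattini_argument:
  assumes p: "Factorial_Ring.prime p" and fin: "finite (carrier G)"
    and L: "L \<lhd> G" and T: "sylow_subgroup p T (G\<lparr>carrier := L\<rparr>)" and g: "g \<in> carrier G"
  shows "\<exists>l \<in> L. \<forall>t \<in> T. (l \<otimes> g) \<otimes> t \<otimes> inv (l \<otimes> g) \<in> T"
proof -
  let ?L = "G\<lparr>carrier := L\<rparr>" and ?c = "\<lambda>t. g \<otimes> t \<otimes> inv g"
  have LG: "subgroup L G" by (rule normal_imp_subgroup[OF L])
  interpret L: group ?L by (rule subgroup_imp_group[OF LG])
  have finL: "finite (carrier ?L)" using fin LG by (auto dest: subgroup.subset finite_subset)
  have pT: "p_subgroup p T G" "T \<subseteq> L"
    using T L.sylow_subgroup_iff[OF p finL] p_subgroup_restrict_iff[OF LG] by blast+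
  have Tc: "t \<in> carrier G" if "t \<in> T" for t
    using that pT(1) by (auto simp: p_subgroup_def dest: subgroup.mem_carrier)
  have Lc: "l \<in> carrier G" if "l \<in> L" for l
    using that LG by (auto dest: subgroup.mem_carrier)
  have "subgroup (?c ` T) G"
    using group_hom.subgroup_img_is_subgroup[OF conj_hom[OF g]] pT(1) by (simp add: p_subgroup_def)
  moreover have "card (?c ` T) = card T"
    using g Tc by (intro card_image inj_onI) simp
  moreover have "?c ` T \<subseteq> L" using normal.inv_op_closed2[OF L g] pT(2) by blast
  ultimately have pcT: "p_subgroup p (?c ` T) ?L"
    using pT(1) subgroup_incl[OF _ LG] by (simp add: p_subgroup_def)
  then obtain l where l: "l \<in> L" "\<forall>q \<in> ?c ` T. l \<otimes> q \<otimes> inv\<^bsub>?L\<^esub> l \<in> T"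
    using L.p_subgroup_conj_into_sylow[OF p finL T pcT] by auto
  have "(l \<otimes> g) \<otimes> t \<otimes> inv (l \<otimes> g) \<in> T" if "t \<in> T" for t
  proof -
    have "l \<otimes> (g \<otimes> t \<otimes> inv g) \<otimes> inv l \<in> T"
      using l that m_inv_consistent[OF LG l(1)] by auto
    then show ?thesis using that g Tc[OF that] Lc[OF l(1)] by (simp add: word_simps)
  qed
  then show ?thesis using l(1) by blast
qed

text \<open>The index of \<open>T C\<close> divides the index \<open>p ^ k\<close> of \<open>C\<close> as well as the index of \<open>T\<close>, which is prime to
\<open>p\<close>.\<close>

lemma (in group) sylow_times_normal_p_index:
  assumes p: "Factorial_Ring.prime p" and fin: "finite (carrier G)"
    and T: "sylow_subgroup p T G" and C: "C \<lhd> G" and index: "order G = card C * p ^ k"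
  shows "T <#> C = carrier G"
proof -
  have TG: "subgroup T G" using T by (simp add: sylow_subgroup_def)
  have CG: "subgroup C G" by (rule normal_imp_subgroup[OF C])
  have TC: "subgroup (T <#> C) G"
    using C TG by (metis commut_normal normal_imp_subgroup mult_norm_subgroup)
  have sub: "T \<subseteq> T <#> C" "C \<subseteq> T <#> C"
    using subgroup.one_closed[OF TG] subgroup.one_closed[OF CG]
      subgroup.mem_carrier[OF TG] subgroup.mem_carrier[OF CG]
    by (force simp: set_mult_def)+
  have lag: "card (rcosets (T <#> C)) * card (T <#> C) = order G" by (rule lagrange[OF TC])
  have "card C > 0"
    using CG fin by (metis card_gt_0_iff empty_iff finite_subset subgroup.one_closed subgroup.subset)
  have "card (rcosets (T <#> C)) dvd p ^ k"
  proof -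
    obtain u where "card (T <#> C) = card C * u" using card_subgroup_dvd[OF CG TC sub(2)] by auto
    then have "card C * (card (rcosets (T <#> C)) * u) = card C * p ^ k"
      using lag index by (metis mult.commute mult.left_commute)
    then show ?thesis using \<open>card C > 0\<close> by (metis dvd_triv_left mult_cancel1 less_irrefl)
  qed
  then obtain j where j: "card (rcosets (T <#> C)) = p ^ j" using divides_primepow_nat[OF p] by blast
  have "\<not> p dvd card (rcosets (T <#> C))"
  proof
    assume "p dvd card (rcosets (T <#> C))"
    moreover obtain v where v: "card (T <#> C) = card T * v"
      using card_subgroup_dvd[OF TG TC sub(1)] by auto
    have "card (rcosets T) * card T = card (rcosets (T <#> C)) * v * card T"
      using lag lagrange[OF TG] v by (simp add: ac_simps)
    moreover have "card T > 0"
      using T p by (simp add: sylow_subgroup_def prime_gt_0_nat)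
    ultimately have "p dvd card (rcosets T)" by simp
    then show False using T sylow_subgroup_iff[OF p fin] by blast
  qed
  then have "j = 0" using j by (cases j) auto
  then have "card (T <#> C) = card (carrier G)" using lag j by (simp add: order_def)
  then show ?thesis using card_subset_eq[OF fin subgroup.subset[OF TC]] by simp
qed

text \<open>The derived subgroup of a nontrivial \<open>p\<close>-group is proper. A maximal proper subgroup \<open>M\<close> is normal in \<open>B\<close> because its
normalizer is larger than \<open>M\<close>. For \<open>b \<in> B - M\<close> the elements that commute with \<open>b\<close> modulo \<open>M\<close>
form a subgroup that contains \<open>M\<close> and \<open>b\<close>, hence is all of \<open>B\<close>.\<close>

lemma (in group) p_group_commutators_in_proper_subgroup:
  assumes p: "Factorial_Ring.prime p" and fin: "finite (carrier G)"
    and B: "p_subgroup p B G" and "B \<noteq> {\<one>}"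
  shows "\<exists>M. subgroup M G \<and> M \<subset> B \<and> (\<forall>b\<in>B. \<forall>c\<in>B. commutator G b c \<in> M)"
proof -
  let ?S = "{M. subgroup M G \<and> M \<subset> B}"
  have BG: "subgroup B G" using B by (simp add: p_subgroup_def)
  have Bc: "b \<in> carrier G" if "b \<in> B" for b using BG that by (rule subgroup.mem_carrier)
  have finB: "finite B" using BG fin by (auto dest: subgroup.subset finite_subset)
  have "finite ?S" using finB by (auto intro: finite_subset[of _ "Pow B"])
  moreover have "{\<one>} \<in> ?S"
    using triv_subgroup \<open>B \<noteq> {\<one>}\<close> subgroup.one_closed[OF BG] by auto
  ultimately obtain M where M: "M \<in> ?S" and max: "\<forall>M' \<in> ?S. M \<subseteq> M' \<longrightarrow> M = M'"
    using finite_has_maximal[of ?S] by blast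
  have MG: "subgroup M G" and MB: "M \<subset> B" using M by auto
  have Mc: "b \<in> carrier G" if "b \<in> M" for b using MG that by (rule subgroup.mem_carrier)
  have whole: "K = B" if "subgroup K G" "K \<subseteq> B" "M \<subseteq> K" "x \<in> K - M" for K x
    using max that by blast
  have normal_M: "\<forall>m\<in>M. b \<otimes> m \<otimes> inv b \<in> M" if "b \<in> B" for b
  proof -
    let ?N = "{b \<in> B. \<forall>m\<in>M. b \<otimes> m \<otimes> inv b \<in> M}"
    obtain x where x: "x \<in> B - M" "\<forall>m\<in>M. x \<otimes> m \<otimes> inv x \<in> M"
      using p_subgroup_normalizer_grows[OF p fin B MG MB] by blast
    have "subgroup ?N G"
      using MB finB Mc by (intro conj_stabilizer_subgroup[OF BG]) (auto dest: finite_subset)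
    moreover have "M \<subseteq> ?N"
      using MB subgroup.m_closed[OF MG] subgroup.m_inv_closed[OF MG] by blast
    ultimately have "?N = B" using x by (intro whole[of _ x]) auto
    then show ?thesis using that by blast
  qed
  have "commutator G b c \<in> M" if b: "b \<in> B" and c: "c \<in> B" for b c
  proof (cases "b \<in> M")
    case True
    have "commutator G b c = inv b \<otimes> (inv c \<otimes> b \<otimes> inv (inv c))"
      using Bc[OF b] Bc[OF c] by (simp add: commutator_def word_simps)
    then show ?thesis
      using True normal_M[of "inv c"] c subgroup.m_inv_closed[OF BG] subgroup.m_closed[OF MG]
        subgroup.m_inv_closed[OF MG] by simp
  next
    case False
    let ?K = "{c \<in> B. commutator G b c \<in> M}"
    have bc: "b \<in> carrier G" using Bc b by simp
    have "subgroup ?K G"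
    proof (rule subgroupI)
      show "?K \<noteq> {}" using b bc subgroup.one_closed[OF MG] by (auto simp: commutator_def word_simps)
      show "inv c \<in> ?K" if c: "c \<in> ?K" for c
      proof -
        have "commutator G b (inv c) = c \<otimes> inv (commutator G b c) \<otimes> inv c"
          using c Bc bc by (simp add: commutator_def word_simps)
        then show ?thesis
          using c normal_M subgroup.m_inv_closed[OF BG] subgroup.m_inv_closed[OF MG] by simp
      qed
      show "c \<otimes> d \<in> ?K" if c: "c \<in> ?K" and d: "d \<in> ?K" for c d
      proof -
        have "commutator G b (c \<otimes> d)
            = commutator G b d \<otimes> (inv d \<otimes> commutator G b c \<otimes> inv (inv d))"
          using c d Bc bc by (simp add: commutator_def word_simps)
        then show ?thesis
          using c d normal_M[of "inv d"] subgroup.m_inv_closed[OF BG] subgroup.m_closed[OF MG]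
            subgroup.m_closed[OF BG] by simp
      qed
    qed (use Bc in blast)
    moreover have "M \<subseteq> ?K"
    proof
      fix m assume m: "m \<in> M"
      have "commutator G b m = (inv b \<otimes> inv m \<otimes> inv (inv b)) \<otimes> m"
        using bc Mc[OF m] by (simp add: commutator_def word_simps)
      then show "m \<in> ?K"
        using m normal_M[of "inv b"] b MB subgroup.m_inv_closed[OF BG] subgroup.m_inv_closed[OF MG]
          subgroup.m_closed[OF MG] by auto
    qed
    moreover have "b \<in> ?K" using b bc subgroup.one_closed[OF MG] by (simp add: commutator_def word_simps)
    ultimately have "?K = B" using False by (intro whole[of _ b]) auto
    then show ?thesis using c by blast
  qed
  then show ?thesis using MG MB by blast
qed

text \<open>Elements of the quotient are cosets, so the union of \<open>O\<^sub>p(G/C)\<close> is its full preimage in \<open>G\<close>.\<close>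

lemma (in group) normal_preimage_p_core:
  assumes p: "Factorial_Ring.prime p" and fin: "finite (carrier G)" and C: "C \<lhd> G"
  defines "L \<equiv> \<Union> (p_core p (G Mod C))"
  shows "L \<lhd> G" and "\<exists>k. card L = card C * p ^ k" and "C \<subseteq> L"
    and "\<And>g. g \<in> carrier G \<Longrightarrow> g <# C \<in> p_core p (G Mod C) \<Longrightarrow> g \<in> L"
proof -
  let ?O = "p_core p (G Mod C)"
  interpret C: normal C G by (rule C)
  interpret Q: group "G Mod C" by (rule C.factorgroup_is_group)
  have finQ: "finite (carrier (G Mod C))"
    using fin by (simp add: carrier_FactGroup)
  have O: "?O \<lhd> G Mod C" by (rule Q.p_core_normal)
  have subO: "subgroup ?O (G Mod C)" by (rule normal_imp_subgroup[OF O])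
  show LG: "L \<lhd> G" unfolding L_def by (rule C.factgroup_subgroup_union_normal[OF O])
  have "rcosets\<^bsub>G\<lparr>carrier := L\<rparr>\<^esub> C = ?O"
    using C.factgroup_subgroup_union_factor[OF subO] by (simp add: L_def FactGroup_def)
  show "C \<subseteq> L"
    using subgroup.one_closed[OF subO] by (auto simp: L_def)
  have LS: "subgroup L G" by (rule normal_imp_subgroup[OF LG])
  have "subgroup C (G\<lparr>carrier := L\<rparr>)"
    using C.subgroup_axioms LS \<open>C \<subseteq> L\<close> by (rule subgroup_incl)
  then have "card ?O * card C = card L"
    using group.lagrange[OF subgroup_imp_group[OF LS]] \<open>rcosets\<^bsub>G\<lparr>carrier := L\<rparr>\<^esub> C = ?O\<close>
    by (fastforce simp: order_def)
  moreover obtain k where "card ?O = p ^ k"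
    using Q.p_core_p_subgroup[OF p finQ] by (auto simp: p_subgroup_def)
  ultimately show "\<exists>k. card L = card C * p ^ k" by (metis mult.commute)
  show "g \<in> L" if "g \<in> carrier G" "g <# C \<in> ?O" for g
  proof -
    have "g \<in> g <# C" using that(1) C.one_closed by (force simp: l_coset_def)
    then show ?thesis using that(2) by (auto simp: L_def)
  qed
qed

section \<open>Largest abelian subgroups and replacement\<close>

definition largest_abelian :: "('a, 'b) monoid_scheme \<Rightarrow> 'a set \<Rightarrow> 'a set set" where
  "largest_abelian G E = {A \<in> abelian_subgroups G E. card A = d_o G E}"

lemma (in group) abelian_subgroups_iff:
  "A \<in> abelian_subgroups G E \<longleftrightarrow>
    subgroup A G \<and> A \<subseteq> E \<and> (\<forall>x \<in> A. \<forall>y \<in> A. x \<otimes> y = y \<otimes> x)"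
proof -
  have "comm_group (G\<lparr>carrier := A\<rparr>) \<longleftrightarrow> (\<forall>x \<in> A. \<forall>y \<in> A. x \<otimes> y = y \<otimes> x)"
    if A: "subgroup A G"
  proof
    assume "comm_group (G\<lparr>carrier := A\<rparr>)"
    then show "\<forall>x \<in> A. \<forall>y \<in> A. x \<otimes> y = y \<otimes> x"
      using comm_monoid.m_comm[OF comm_group.axioms(1)] by fastforce
  next
    assume "\<forall>x \<in> A. \<forall>y \<in> A. x \<otimes> y = y \<otimes> x"
    then show "comm_group (G\<lparr>carrier := A\<rparr>)"
      by (intro group.group_comm_groupI[OF subgroup_imp_group[OF A]]) simp
  qed
  then show ?thesis by (auto simp: abelian_subgroups_def)
qed

lemma finite_abelian_subgroups:
  assumes "finite (carrier G)"
  shows "finite (abelian_subgroups G E)"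
  using assms by (auto simp: abelian_subgroups_def intro: finite_subset[of _ "Pow (carrier G)"]
      dest: subgroup.mem_carrier)

lemma largest_abelian_iff:
  assumes fin: "finite (carrier G)"
  shows "A \<in> largest_abelian G E \<longleftrightarrow>
    A \<in> abelian_subgroups G E \<and> (\<forall>A' \<in> abelian_subgroups G E. card A' \<le> card A)"
  using finite_abelian_subgroups[OF fin, of E]
  by (auto simp: largest_abelian_def d_o_def intro!: antisym Max_ge Max.boundedI)

lemma (in group) largest_abelian_exists:
  assumes fin: "finite (carrier G)" and E: "subgroup E G"
  shows "largest_abelian G E \<noteq> {}"
proof -
  have "{\<one>} \<in> abelian_subgroups G E"
    using triv_subgroup subgroup.one_closed[OF E] by (simp add: abelian_subgroups_iff)
  then have "d_o G E \<in> card ` abelian_subgroups G E"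
    unfolding d_o_def using finite_abelian_subgroups[OF fin] by (intro Max_in) auto
  then show ?thesis by (auto simp: largest_abelian_def)
qed

lemma (in group) centralizer_subgroup:
  assumes "X \<subseteq> carrier G"
  shows "subgroup (centralizer G X) G"
proof (rule subgroupI)
  show "centralizer G X \<noteq> {}" using assms by (auto simp: centralizer_def intro!: exI[of _ \<one>])
  show "inv a \<in> centralizer G X" if "a \<in> centralizer G X" for a
  proof -
    have "inv a \<otimes> x = x \<otimes> inv a" if x: "x \<in> X" for x
    proof -
      have c: "a \<in> carrier G" "x \<in> carrier G" "a \<otimes> x = x \<otimes> a"
        using x assms \<open>a \<in> centralizer G X\<close> by (auto simp: centralizer_def)
      then have "inv a \<otimes> x = inv a \<otimes> (x \<otimes> a) \<otimes> inv a" by (simp add: word_simps)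
      also have "\<dots> = inv a \<otimes> (a \<otimes> x) \<otimes> inv a" using c by simp
      also have "\<dots> = x \<otimes> inv a" using c(1,2) by (simp add: word_simps)
      finally show ?thesis .
    qed
    then show ?thesis using that by (simp add: centralizer_def)
  qed
  show "a \<otimes> b \<in> centralizer G X" if "a \<in> centralizer G X" "b \<in> centralizer G X" for a b
  proof -
    have "a \<otimes> b \<otimes> x = x \<otimes> (a \<otimes> b)" if x: "x \<in> X" for x
    proof -
      have "a \<otimes> b \<otimes> x = a \<otimes> (x \<otimes> b)"
        using x assms \<open>a \<in> _\<close> \<open>b \<in> _\<close> by (auto simp: centralizer_def m_assoc subset_iff)
      also have "\<dots> = x \<otimes> (a \<otimes> b)"
        using x assms \<open>a \<in> _\<close> \<open>b \<in> _\<close> by (auto simp: centralizer_def m_assoc[symmetric] subset_iff)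
      finally show ?thesis .
    qed
    then show ?thesis using that by (simp add: centralizer_def)
  qed
qed (auto simp: centralizer_def)

lemma (in group) generate_commute:
  assumes X: "X \<subseteq> carrier G" and Y: "Y \<subseteq> carrier G"
    and comm: "\<And>x y. x \<in> X \<Longrightarrow> y \<in> Y \<Longrightarrow> x \<otimes> y = y \<otimes> x"
    and x: "x \<in> generate G X" and y: "y \<in> generate G Y"
  shows "x \<otimes> y = y \<otimes> x"
proof -
  have "generate G X \<subseteq> centralizer G Y"
    using X comm by (intro generate_subgroup_incl[OF _ centralizer_subgroup[OF Y]])
      (auto simp: centralizer_def)
  then have "Y \<subseteq> centralizer G (generate G X)"
    using Y by (force simp: centralizer_def)
  then have "generate G Y \<subseteq> centralizer G (generate G X)"
    by (intro generate_subgroup_incl centralizer_subgroup generate_incl X)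
  then show ?thesis using x y by (force simp: centralizer_def)
qed

text \<open>Otherwise \<open>A\<close> and \<open>z\<close> would generate a larger abelian subgroup.\<close>

lemma (in group) largest_abelian_self_centralizing:
  assumes fin: "finite (carrier G)" and E: "subgroup E G" and A: "A \<in> largest_abelian G E"
    and z: "z \<in> E" and comm: "\<And>a. a \<in> A \<Longrightarrow> z \<otimes> a = a \<otimes> z"
  shows "z \<in> A"
proof -
  have AG: "subgroup A G" "A \<subseteq> E" "\<And>x y. x \<in> A \<Longrightarrow> y \<in> A \<Longrightarrow> x \<otimes> y = y \<otimes> x"
    using A by (auto simp: largest_abelian_def abelian_subgroups_iff)
  have sub: "insert z A \<subseteq> carrier G"
    using z AG(1) subgroup.subset[OF E] by (auto dest: subgroup.mem_carrier)
  have "x \<otimes> y = y \<otimes> x" if "x \<in> generate G (insert z A)" "y \<in> generate G (insert z A)" for x y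
    by (rule generate_commute[OF sub sub _ that]) (auto simp: comm AG(3))
  then have "generate G (insert z A) \<in> abelian_subgroups G E"
    using generate_is_subgroup[OF sub] generate_subgroup_incl[OF _ E, of "insert z A"] z AG
    by (simp add: abelian_subgroups_iff)
  then have "card (generate G (insert z A)) \<le> card A"
    using A by (simp add: largest_abelian_iff[OF fin])
  moreover have "A \<subseteq> generate G (insert z A)" by (auto intro: generate.incl)
  moreover have "finite (generate G (insert z A))"
    using generate_incl[OF sub] fin finite_subset by blast
  ultimately have "A = generate G (insert z A)" by (metis card_seteq)
  moreover have "z \<in> generate G (insert z A)" by (auto intro: generate.incl)
  ultimately show ?thesis by simp
qed

lemma (in group) commutator_closed [simp]:
  "x \<in> carrier G \<Longrightarrow> y \<in> carrier G \<Longrightarrow> commutator G x y \<in> carrier G"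
  by (simp add: commutator_def)

lemma (in group) commutator_conj:
  assumes "x \<in> carrier G" "y \<in> carrier G" "g \<in> carrier G"
  shows "inv g \<otimes> commutator G x y \<otimes> g = commutator G (inv g \<otimes> x \<otimes> g) (inv g \<otimes> y \<otimes> g)"
  using assms by (simp add: commutator_def word_simps)

lemma (in group) conj_eq_commutator:
  assumes "x \<in> carrier G" "y \<in> carrier G"
  shows "inv y \<otimes> x \<otimes> y = x \<otimes> commutator G x y"
  using assms by (simp add: commutator_def word_simps)

lemma (in group) commutator_eq_one_iff:
  assumes "x \<in> carrier G" "y \<in> carrier G"
  shows "commutator G x y = \<one> \<longleftrightarrow> x \<otimes> y = y \<otimes> x"
proof -
  have "x \<otimes> y = y \<otimes> x \<otimes> commutator G x y"
    using assms by (simp add: commutator_def word_simps)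
  then have "x \<otimes> y = y \<otimes> x \<longleftrightarrow> y \<otimes> x \<otimes> commutator G x y = y \<otimes> x \<otimes> \<one>"
    using assms by simp
  also have "\<dots> \<longleftrightarrow> commutator G x y = \<one>" using assms by (intro Units_l_cancel) auto
  finally show ?thesis by simp
qed

lemma (in group) commutator_mult_left:
  assumes c: "u \<in> carrier G" "v \<in> carrier G" "w \<in> carrier G"
    and comm: "commutator G u w \<otimes> v = v \<otimes> commutator G u w"
  shows "commutator G (u \<otimes> v) w = commutator G u w \<otimes> commutator G v w"
proof -
  have "commutator G (u \<otimes> v) w = inv v \<otimes> (commutator G u w \<otimes> v) \<otimes> commutator G v w"
    using c by (simp add: commutator_def word_simps)
  also have "\<dots> = commutator G u w \<otimes> commutator G v w"
    using c by (simp add: comm cancel_inv_left)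
  finally show ?thesis .
qed

lemma (in group) commutator_mult_right:
  assumes c: "u \<in> carrier G" "v \<in> carrier G" "w \<in> carrier G"
    and comm: "commutator G u v \<otimes> w = w \<otimes> commutator G u v"
  shows "commutator G u (v \<otimes> w) = commutator G u w \<otimes> commutator G u v"
proof -
  have "commutator G u (v \<otimes> w) = commutator G u w \<otimes> (inv w \<otimes> (commutator G u v \<otimes> w))"
    using c by (simp add: commutator_def word_simps)
  also have "\<dots> = commutator G u w \<otimes> commutator G u v"
    using c by (simp add: comm cancel_inv_left)
  finally show ?thesis .
qed

lemma (in group) commutator_absorb_central:
  assumes c: "x \<in> carrier G" "a \<in> carrier G" "z \<in> carrier G"
    and comm: "z \<otimes> x = x \<otimes> z" "z \<otimes> a = a \<otimes> z"
  shows "commutator G (x \<otimes> z) a = commutator G x a"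
proof -
  have "commutator G z a = \<one>" using c comm by (simp add: commutator_eq_one_iff)
  moreover have "commutator G x a \<in> centralizer G {z}"
  proof -
    have S: "subgroup (centralizer G {z}) G" using c by (intro centralizer_subgroup) simp
    have "x \<in> centralizer G {z}" "a \<in> centralizer G {z}" using c comm by (auto simp: centralizer_def)
    then show ?thesis
      by (simp add: commutator_def subgroup.m_closed[OF S] subgroup.m_inv_closed[OF S])
  qed
  ultimately show ?thesis
    using commutator_mult_left[of x z a] c by (simp add: centralizer_def)
qed

text \<open>Write \<open>M\<close> for the subgroup generated by the commutators \<open>[x,a]\<close> with \<open>a \<in> A\<close>, so that
\<open>C = C\<^sub>A(M)\<close>. The abelian group \<open>M C\<close> is at least as large as \<open>A\<close>: the elements of \<open>A\<close> are
\<open>r c\<close> with \<open>c \<in> C\<close> and \<open>r\<close> from a fixed set of representatives of the cosets of \<open>C\<close>, and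
\<open>r c \<mapsto> [x,r] c\<close> is injective. The reason is that \<open>[x,r]\<close> and \<open>[x,s]\<close> can agree up to an element of
\<open>A\<close> only if \<open>r\<close> and \<open>s\<close> lie in the same coset of \<open>C\<close>.\<close>

lemma (in group) thompson_replacement_step:
  assumes fin: "finite (carrier G)" and E: "subgroup E G" and A: "A \<in> largest_abelian G E"
    and x: "x \<in> carrier G" and ME: "commutator G x ` A \<subseteq> E"
    and Mcomm: "\<And>a b. a \<in> A \<Longrightarrow> b \<in> A \<Longrightarrow>
      commutator G x a \<otimes> commutator G x b = commutator G x b \<otimes> commutator G x a"
  defines "C \<equiv> {c \<in> A. \<forall>a \<in> A. c \<otimes> commutator G x a = commutator G x a \<otimes> c}"
  shows "generate G (commutator G x ` A \<union> C) \<in> largest_abelian G E"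
proof -
  have AG: "subgroup A G" "A \<subseteq> E" and Acomm: "\<And>x y. x \<in> A \<Longrightarrow> y \<in> A \<Longrightarrow> x \<otimes> y = y \<otimes> x"
    using A by (auto simp: largest_abelian_def abelian_subgroups_iff)
  have Ac: "a \<in> carrier G" if "a \<in> A" for a using AG(1) that by (rule subgroup.mem_carrier)
  let ?M = "commutator G x ` A"
  let ?A' = "generate G (?M \<union> C)"
  have sub: "?M \<union> C \<subseteq> carrier G" using Ac x by (auto simp: C_def)
  have CS: "subgroup C G"
  proof -
    have "C = A \<inter> centralizer G ?M" using Ac by (auto simp: C_def centralizer_def)
    then show ?thesis
      using subgroups_Inter_pair[OF AG(1) centralizer_subgroup[of ?M]] sub by simp
  qed
  have "x' \<otimes> y = y \<otimes> x'" if "x' \<in> ?A'" "y \<in> ?A'" for x' y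
    by (rule generate_commute[OF sub sub _ that]) (auto simp: C_def Mcomm Acomm)
  moreover have "?M \<union> C \<subseteq> E" using ME AG(2) by (auto simp: C_def)
  ultimately have A': "?A' \<in> abelian_subgroups G E"
    using generate_is_subgroup[OF sub] generate_subgroup_incl[OF _ E]
    by (simp add: abelian_subgroups_iff)
  have key: "s \<otimes> inv r \<in> C"
    if r: "r \<in> A" and s: "s \<in> A" and inA: "inv (commutator G x r) \<otimes> commutator G x s \<in> A" for r s
  proof -
    \<comment> \<open>The given element of \<open>A\<close> equals \<open>u = [x,w]\<close>. As \<open>w\<close> takes \<open>x\<close> to \<open>x \<otimes> u\<close> and fixes \<open>A\<close>, it acts on
      \<open>[x,a]\<close> like \<open>u\<close>, which is itself one of these mutually commuting commutators.\<close>
    define w where "w = s \<otimes> inv r"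
    define u where "u = commutator G x w"
    have w: "w \<in> A" using r s AG(1) by (simp add: w_def subgroup.m_closed subgroup.m_inv_closed)
    have "r \<otimes> (inv (commutator G x r) \<otimes> commutator G x s) \<otimes> inv r = u"
      using r s Ac x by (simp add: u_def w_def commutator_def word_simps)
    moreover have "r \<otimes> (inv (commutator G x r) \<otimes> commutator G x s) \<otimes> inv r
        = inv (commutator G x r) \<otimes> commutator G x s"
      using r s Ac x inA by (subst Acomm[OF r inA]) (simp add: word_simps)
    ultimately have u: "u \<in> A" using inA by simp
    have "w \<otimes> commutator G x a = commutator G x a \<otimes> w" if a: "a \<in> A" for a
    proof -
      have "inv w \<otimes> commutator G x a \<otimes> w = commutator G (x \<otimes> u) a"
        using commutator_conj[of x a w] conj_eq_commutator[of x w] Acomm[OF a w] a w Ac x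
        by (simp add: u_def word_simps)
      also have "\<dots> = inv u \<otimes> commutator G x a \<otimes> u"
      proof -
        have "commutator G (x \<otimes> u) a = inv u \<otimes> inv x \<otimes> inv a \<otimes> x \<otimes> (u \<otimes> a)"
          using a u Ac x by (simp add: commutator_def word_simps)
        also have "\<dots> = inv u \<otimes> commutator G x a \<otimes> u"
          unfolding Acomm[OF u a] using a u Ac x by (simp add: commutator_def word_simps)
        finally show ?thesis .
      qed
      also have "\<dots> = commutator G x a"
      proof -
        have "inv u \<otimes> commutator G x a \<otimes> u = inv u \<otimes> (u \<otimes> commutator G x a)"
          using Mcomm[OF a w] a u Ac x by (simp add: u_def m_assoc)
        then show ?thesis using a u Ac x by (simp add: cancel_inv_left)
      qed
      finally have "w \<otimes> (inv w \<otimes> commutator G x a \<otimes> w) = w \<otimes> commutator G x a" by simp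
      then show ?thesis using a w Ac x by (simp add: m_assoc cancel_inv_left)
    qed
    then show ?thesis using w by (simp add: C_def w_def)
  qed
  \<comment> \<open>\<open>r a\<close> depends only on the coset of \<open>a\<close>.\<close>
  define r where "r = (\<lambda>a. SOME b. b \<in> C #> a)"
  have r: "r a \<in> C #> a" if "a \<in> A" for a
    unfolding r_def using rcos_self[OF Ac[OF that] CS] by (rule someI)
  have CA: "C \<subseteq> A" by (auto simp: C_def)
  have rA: "r a \<in> A" and rC: "inv (r a) \<otimes> a \<in> C" if a: "a \<in> A" for a
  proof -
    obtain c where c: "c \<in> C" "r a = c \<otimes> a" using r[OF a] by (auto simp: r_coset_def)
    then show "r a \<in> A" using CA a AG(1) by (auto intro: subgroup.m_closed)
    have "inv (r a) \<otimes> a = inv a \<otimes> (inv c \<otimes> a)"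
      using c a Ac CA by (auto simp: word_simps)
    also have "\<dots> = inv c"
      using Acomm[of "inv c" a] c a CA AG(1) Ac by (auto simp: subgroup.m_inv_closed cancel_inv_left)
    finally show "inv (r a) \<otimes> a \<in> C" using c(1) CS by (simp add: subgroup.m_inv_closed)
  qed
  define f where "f = (\<lambda>a. commutator G x (r a) \<otimes> (inv (r a) \<otimes> a))"
  have "card A \<le> card ?A'"
  proof (rule card_inj_on_le)
    show "inj_on f A"
    proof (rule inj_onI)
      fix a b assume a: "a \<in> A" and b: "b \<in> A" and eq: "f a = f b"
      let ?c = "inv (r a) \<otimes> a" and ?d = "inv (r b) \<otimes> b"
      have c: "?c \<in> A" "?d \<in> A" using rC a b CA by auto
      have cc: "commutator G x (r a) \<in> carrier G" "commutator G x (r b) \<in> carrier G"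
         "?c \<in> carrier G" "?d \<in> carrier G"
        using Ac c rA a b x by auto
      have "inv (commutator G x (r a)) \<otimes> commutator G x (r b)
          = inv (commutator G x (r a)) \<otimes> (commutator G x (r b) \<otimes> ?d) \<otimes> inv ?d"
        using cc by (simp only: m_assoc r_inv m_closed inv_closed r_one)
      also have "\<dots> = inv (commutator G x (r a)) \<otimes> (commutator G x (r a) \<otimes> ?c) \<otimes> inv ?d"
        using eq by (simp add: f_def)
      also have "\<dots> = ?c \<otimes> inv ?d" using cc by (simp only: cancel_inv_left)
      finally have "inv (commutator G x (r a)) \<otimes> commutator G x (r b) \<in> A"
        using c AG(1) by (simp add: subgroup.m_closed subgroup.m_inv_closed)
      from key[OF rA[OF a] rA[OF b] this] have "r b \<otimes> inv (r a) \<otimes> r a \<in> C #> r a"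
        by (auto simp: r_coset_def)
      then have "r b \<in> C #> r a" using Ac rA a b by (simp add: m_assoc)
      moreover have "C #> r a = C #> a" "C #> r b = C #> b"
        using repr_independence[OF r _ CS] Ac a b by auto
      ultimately have "C #> a = C #> b"
        using repr_independence[of "r b" C "r a", OF _ _ CS] Ac rA a by simp
      then have "r a = r b" by (simp add: r_def)
      then show "a = b" using eq cc rA a b Ac x by (simp add: f_def)
    qed
    show "f ` A \<subseteq> ?A'"
    proof (rule image_subsetI)
      fix a assume a: "a \<in> A"
      have "commutator G x (r a) \<in> ?A'" "inv (r a) \<otimes> a \<in> ?A'"
        using rA[OF a] rC[OF a] by (auto intro: generate.incl)
      then show "f a \<in> ?A'" unfolding f_def by (rule generate.eng)
    qed
    show "finite ?A'" using generate_incl[OF sub] fin finite_subset by blast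
  qed
  then show ?thesis
    using A A' unfolding largest_abelian_iff[OF fin] by (meson order_trans)
qed

lemma (in group) set_mult_subgroup:
  assumes A: "subgroup A G" and N: "subgroup N G"
    and norm: "\<And>a n. a \<in> A \<Longrightarrow> n \<in> N \<Longrightarrow> a \<otimes> n \<otimes> inv a \<in> N"
  shows "subgroup (A <#> N) G"
proof (rule subgroupI)
  have Ac: "a \<in> carrier G" if "a \<in> A" for a using A that by (rule subgroup.mem_carrier)
  have Nc: "a \<in> carrier G" if "a \<in> N" for a using N that by (rule subgroup.mem_carrier)
  show "A <#> N \<subseteq> carrier G" using Ac Nc by (auto simp: set_mult_def)
  show "A <#> N \<noteq> {}" using subgroup.one_closed[OF A] subgroup.one_closed[OF N]
    by (auto simp: set_mult_def)
  show "inv y \<in> A <#> N" if y: "y \<in> A <#> N" for y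
  proof -
    obtain a n where y: "a \<in> A" "n \<in> N" "y = a \<otimes> n" using y by (auto simp: set_mult_def)
    then have "inv y = inv a \<otimes> (a \<otimes> inv n \<otimes> inv a)" using Ac Nc by (simp add: word_simps)
    then show ?thesis
      using y norm[of a "inv n"] subgroup.m_inv_closed[OF A] subgroup.m_inv_closed[OF N]
      by (auto simp: set_mult_def)
  qed
  show "y \<otimes> z \<in> A <#> N" if y: "y \<in> A <#> N" and z: "z \<in> A <#> N" for y z
  proof -
    obtain a n where y: "a \<in> A" "n \<in> N" "y = a \<otimes> n" using y by (auto simp: set_mult_def)
    obtain b m where z: "b \<in> A" "m \<in> N" "z = b \<otimes> m" using z by (auto simp: set_mult_def)
    have "y \<otimes> z = (a \<otimes> b) \<otimes> ((inv b \<otimes> n \<otimes> inv (inv b)) \<otimes> m)"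
      using y z Ac Nc by (simp add: word_simps)
    moreover have "inv b \<otimes> n \<otimes> inv (inv b) \<in> N"
      using norm[of "inv b" n] subgroup.m_inv_closed[OF A] y z by blast
    ultimately show ?thesis
      using y z subgroup.m_closed[OF A] subgroup.m_closed[OF N]
      by (force simp: set_mult_def)
  qed
qed

text \<open>An element \<open>t \<noteq> \<one>\<close> with \<open>t \<otimes> t = \<one>\<close> would span a subgroup of order \<open>2\<close>.\<close>

lemma (in group) no_involution_in_odd_p_subgroup:
  assumes p: "Factorial_Ring.prime p" and "odd p" and E: "p_subgroup p E G"
    and t: "t \<in> E" "t \<otimes> t = \<one>"
  shows "t = \<one>"
proof (rule ccontr)
  assume "t \<noteq> \<one>"
  have ES: "subgroup E G" using E by (simp add: p_subgroup_def)
  have tc: "t \<in> carrier G" using ES t(1) by (rule subgroup.mem_carrier)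
  have "inv t = t" using tc t(2) by (simp add: inv_equality)
  have "subgroup {\<one>, t} G"
    using tc t(2) \<open>inv t = t\<close> by (intro subgroupI) auto
  then have "card {\<one>, t} dvd card E"
    using ES t(1) by (intro card_subgroup_dvd) (auto simp: subgroup.one_closed)
  moreover have "card {\<one>, t} = 2" using \<open>t \<noteq> \<one>\<close> by simp
  ultimately have "even (card E)" by simp
  then show False using E \<open>odd p\<close> by (auto simp: p_subgroup_def)
qed

text \<open>This is where \<open>p\<close> has to be odd. Let \<open>c = [x,a]\<close> and \<open>d = [x,b]\<close>. These normalize \<open>A\<close>, so the
error terms \<open>e = [c,b]\<close> and \<open>f = [d,a]\<close> lie in \<open>A \<inter> B\<close>, which commutes with all \<open>[x,a]\<close>. Computing
the conjugate of \<open>x\<close> by \<open>a b = b a\<close> in two ways shows \<open>e = [c,d] f\<close>, so \<open>[x,e] = [x,f]\<close> since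
\<open>[c,d]\<close> is central in \<open>B\<close>. As \<open>A\<close> centralizes \<open>[B,B]\<close>, conjugation by \<open>b\<close> fixes \<open>[x,c]\<close>; expanding
bilinearly, this says \<open>[x,e] [d,c] = 1\<close>, and symmetrically \<open>[x,f] [c,d] = 1\<close>. Thus
\<open>[c,d] = [d,c]\<close>, and \<open>[c,d]\<close> has square \<open>1\<close>.\<close>

lemma (in group) class_two_commutators_commute:
  assumes p: "Factorial_Ring.prime p" and odd: "odd p" and B: "p_subgroup p B G"
    and A: "subgroup A G" and finA: "finite A"
    and Acomm: "\<And>a b. a \<in> A \<Longrightarrow> b \<in> A \<Longrightarrow> a \<otimes> b = b \<otimes> a"
    and normB: "\<And>a b. a \<in> A \<Longrightarrow> b \<in> B \<Longrightarrow> a \<otimes> b \<otimes> inv a \<in> B"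
    and central: "\<And>b c y. b \<in> B \<Longrightarrow> c \<in> B \<Longrightarrow> y \<in> A \<union> B \<Longrightarrow>
      commutator G b c \<otimes> y = y \<otimes> commutator G b c"
    and x: "x \<in> B"
    and normA: "\<And>a c. a \<in> A \<Longrightarrow> c \<in> A \<Longrightarrow> commutator G x a \<otimes> c \<otimes> inv (commutator G x a) \<in> A"
  shows "\<And>a y. a \<in> A \<Longrightarrow> y \<in> A \<inter> B \<Longrightarrow> y \<otimes> commutator G x a = commutator G x a \<otimes> y"
    and "\<And>a b. a \<in> A \<Longrightarrow> b \<in> A \<Longrightarrow>
      commutator G x a \<otimes> commutator G x b = commutator G x b \<otimes> commutator G x a"
proof -
  have BG: "subgroup B G" using B by (simp add: p_subgroup_def)
  have Ac: "a \<in> carrier G" if "a \<in> A" for a using A that by (rule subgroup.mem_carrier)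
  have Bc: "a \<in> carrier G" if "a \<in> B" for a using BG that by (rule subgroup.mem_carrier)
  have xc: "x \<in> carrier G" using Bc x by simp
  have inB: "inv a \<otimes> b \<otimes> a \<in> B" if "a \<in> A" "b \<in> B" for a b
    using normB[of "inv a" b] that subgroup.m_inv_closed[OF A] Ac by simp
  have BB: "commutator G b c \<in> B" if "b \<in> B" "c \<in> B" for b c
    using that by (simp add: commutator_def subgroup.m_closed[OF BG] subgroup.m_inv_closed[OF BG])
  have commB: "commutator G b a \<in> B" if "a \<in> A" "b \<in> B" for a b
  proof -
    have "commutator G b a = inv b \<otimes> (inv a \<otimes> b \<otimes> a)"
      using that Ac Bc by (simp add: commutator_def word_simps)
    then show ?thesis
      using inB[OF that] that subgroup.m_closed[OF BG] subgroup.m_inv_closed[OF BG] by simp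
  qed
  show meet: "y \<otimes> commutator G x a = commutator G x a \<otimes> y" if a: "a \<in> A" and y: "y \<in> A \<inter> B" for a y
  proof -
    have c: "a \<in> carrier G" "y \<in> carrier G" using a y Ac by auto
    have "inv y \<otimes> commutator G x a \<otimes> y = commutator G (x \<otimes> commutator G x y) a"
      using commutator_conj[of x a y] conj_eq_commutator[of x y] c xc Acomm[of a y] a y
      by (simp add: m_assoc cancel_inv_left)
    also have "\<dots> = commutator G x a"
      using a y x c xc central[of x y] by (intro commutator_absorb_central) auto
    finally have "y \<otimes> (inv y \<otimes> commutator G x a \<otimes> y) = y \<otimes> commutator G x a" by simp
    then show ?thesis using c xc by (simp add: m_assoc cancel_inv_left)
  qed
  show "commutator G x a \<otimes> commutator G x b = commutator G x b \<otimes> commutator G x a"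
    if a: "a \<in> A" and b: "b \<in> A" for a b
  proof -
    define c where "c = commutator G x a"
    define d where "d = commutator G x b"
    have cB: "c \<in> B" and dB: "d \<in> B" using a b x commB by (auto simp: c_def d_def)
    have car: "a \<in> carrier G" "b \<in> carrier G" "c \<in> carrier G" "d \<in> carrier G"
      using a b cB dB Ac Bc by auto
    have error_term: "commutator G (commutator G x a') b' \<in> A \<inter> B" if "a' \<in> A" "b' \<in> A" for a' b'
    proof -
      let ?c = "commutator G x a'"
      have stab: "subgroup {y \<in> carrier G. \<forall>t\<in>A. y \<otimes> t \<otimes> inv y \<in> A} G"
        using Ac by (intro conj_stabilizer_subgroup[OF subgroup_self finA]) auto
      have "commutator G ?c b' = (inv ?c \<otimes> inv b' \<otimes> inv (inv ?c)) \<otimes> b'"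
        using that Ac xc by (simp add: commutator_def word_simps)
      moreover have "inv ?c \<otimes> inv b' \<otimes> inv (inv ?c) \<in> A"
        using subgroup.m_inv_closed[OF stab, of ?c] normA that subgroup.m_inv_closed[OF A] Ac xc by auto
      ultimately show ?thesis
        using commB[OF that(2) commB[OF that(1) x]] that subgroup.m_closed[OF A] by simp
    qed
    define e where "e = commutator G c b"
    define f where "f = commutator G d a"
    have e: "e \<in> A \<inter> B" and f: "f \<in> A \<inter> B"
      using error_term a b by (auto simp: e_def f_def c_def d_def)
    have ef: "e \<in> B" "f \<in> B" "e \<in> carrier G" "f \<in> carrier G" using e f Bc by auto
    have ed: "e \<otimes> d = d \<otimes> e" and ec: "e \<otimes> c = c \<otimes> e" and fd: "f \<otimes> d = d \<otimes> f" and fc: "f \<otimes> c = c \<otimes> f"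
      using meet e f a b by (auto simp: c_def d_def)
    have xa: "inv a \<otimes> x \<otimes> a = x \<otimes> c" and xb: "inv b \<otimes> x \<otimes> b = x \<otimes> d"
      and cb: "inv b \<otimes> c \<otimes> b = c \<otimes> e" and da: "inv a \<otimes> d \<otimes> a = d \<otimes> f"
      using conj_eq_commutator car xc by (auto simp: c_def d_def e_def f_def)
    have conj_mult: "inv g \<otimes> (u \<otimes> v) \<otimes> g = (inv g \<otimes> u \<otimes> g) \<otimes> (inv g \<otimes> v \<otimes> g)"
      if "u \<in> carrier G" "v \<in> carrier G" "g \<in> carrier G" for u v g
      using that by (simp add: word_simps)
    have "inv b \<otimes> (inv a \<otimes> x \<otimes> a) \<otimes> b = inv a \<otimes> (inv b \<otimes> x \<otimes> b) \<otimes> a"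
    proof -
      have "inv b \<otimes> (inv a \<otimes> x \<otimes> a) \<otimes> b = inv (a \<otimes> b) \<otimes> x \<otimes> (a \<otimes> b)"
        using car xc by (simp add: word_simps)
      also have "\<dots> = inv (b \<otimes> a) \<otimes> x \<otimes> (b \<otimes> a)" by (simp add: Acomm[OF a b])
      also have "\<dots> = inv a \<otimes> (inv b \<otimes> x \<otimes> b) \<otimes> a" using car xc by (simp add: word_simps)
      finally show ?thesis .
    qed
    then have "x \<otimes> d \<otimes> (c \<otimes> e) = x \<otimes> c \<otimes> (d \<otimes> f)"
      using car xc by (simp add: xa xb conj_mult cb da)
    then have dce: "d \<otimes> c \<otimes> e = c \<otimes> d \<otimes> f"
      using car xc ef by (simp add: m_assoc)
    have cd_eq: "c \<otimes> d = d \<otimes> c \<otimes> commutator G c d"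
      using car by (simp add: commutator_def word_simps)
    have e_eq: "e = commutator G c d \<otimes> f"
      using dce car ef unfolding cd_eq by (simp add: m_assoc)
    have xe: "commutator G x e = commutator G x f"
    proof -
      have "commutator G x (commutator G c d) = \<one>"
        using central[OF cB dB, of x] x car xc by (simp add: commutator_eq_one_iff)
      moreover have "commutator G x (commutator G c d \<otimes> f)
          = commutator G x f \<otimes> commutator G x (commutator G c d)"
        using calculation car xc ef by (intro commutator_mult_right) auto
      ultimately show ?thesis using e_eq car xc ef by simp
    qed
    have invariant: "commutator G x g \<otimes> commutator G h c' = \<one>"
      if "h \<in> B" "c' \<in> B" "g \<in> B" "t \<in> A" "g \<otimes> h = h \<otimes> g"
        "inv t \<otimes> x \<otimes> t = x \<otimes> h" "inv t \<otimes> c' \<otimes> t = c' \<otimes> g" for g h c' t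
    proof -
      have hc: "h \<in> carrier G" "c' \<in> carrier G" "g \<in> carrier G" "t \<in> carrier G"
        using that Ac Bc by auto
      have q: "commutator G x c' \<in> carrier G" "commutator G x g \<in> carrier G" "commutator G h c' \<in> carrier G"
        using hc xc by auto
      have "commutator G x c' = inv t \<otimes> (commutator G x c' \<otimes> t)"
        using central[OF x that(2), of t] that(4) hc xc by (simp add: cancel_inv_left)
      also have "\<dots> = commutator G (x \<otimes> h) (c' \<otimes> g)"
        using commutator_conj[of x c' t] hc xc that(6,7) by (simp add: m_assoc)
      also have "\<dots> = commutator G x (c' \<otimes> g) \<otimes> commutator G h (c' \<otimes> g)"
        using that x BG hc xc
        by (intro commutator_mult_left central) (auto simp: subgroup.m_closed)
      also have "commutator G x (c' \<otimes> g) = commutator G x g \<otimes> commutator G x c'"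
        using that x hc xc by (intro commutator_mult_right central) auto
      also have "commutator G h (c' \<otimes> g) = commutator G h g \<otimes> commutator G h c'"
        using that x hc xc by (intro commutator_mult_right central) auto
      also have "commutator G h g = \<one>" using that(5) hc by (simp add: commutator_eq_one_iff)
      also have "commutator G x g \<otimes> commutator G x c' = commutator G x c' \<otimes> commutator G x g"
        using central[OF x that(3), of "commutator G x c'"] BB[OF x that(2)] by simp
      finally have "commutator G x c' \<otimes> \<one> = commutator G x c' \<otimes> (commutator G x g \<otimes> commutator G h c')"
        using q by (simp add: m_assoc)
      then show ?thesis using q by simp
    qed
    have "commutator G x e \<otimes> commutator G d c = \<one>"
      using e b by (intro invariant[of d c e b] cB dB ed xb cb) auto
    moreover have "commutator G x f \<otimes> commutator G c d = \<one>"
      using f a by (intro invariant[of c d f a] cB dB fc xa da) auto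
    ultimately have "commutator G x f \<otimes> commutator G d c = commutator G x f \<otimes> commutator G c d"
      using xe by simp
    then have "commutator G d c = commutator G c d" using xc ef car by simp
    moreover have "commutator G d c \<otimes> commutator G c d = \<one>"
      using car by (simp add: commutator_def word_simps)
    ultimately have "commutator G c d = \<one>"
      using no_involution_in_odd_p_subgroup[OF p odd B BB[OF cB dB]] by simp
    then show ?thesis using commutator_eq_one_iff[of c d] car by (simp add: c_def d_def)
  qed
qed

text \<open>Let \<open>N\<close> be the normalizer of \<open>A\<close> in \<open>B\<close>. Since normalizers grow in the \<open>p\<close>-group \<open>A B\<close>, there is
\<open>x \<in> B - N\<close> with \<open>[x,a] \<in> N\<close> for all \<open>a \<in> A\<close>. These commutators commute with each other and with
\<open>A \<inter> B\<close>, so Thompson's construction applies to them. It keeps \<open>A \<inter> B\<close> and adds to the intersection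
the elements \<open>[x,a]\<close>, of which some lies outside \<open>A\<close> because \<open>x\<close> does not normalize \<open>A\<close>.\<close>

lemma (in group) glauberman_replacement:
  assumes p: "Factorial_Ring.prime p" and odd: "odd p" and fin: "finite (carrier G)"
    and E: "p_subgroup p E G" and A: "A \<in> largest_abelian G E"
    and B: "subgroup B G" "B \<subseteq> E"
    and normB: "\<And>a b. a \<in> A \<Longrightarrow> b \<in> B \<Longrightarrow> a \<otimes> b \<otimes> inv a \<in> B"
    and central: "\<And>b c y. b \<in> B \<Longrightarrow> c \<in> B \<Longrightarrow> y \<in> A \<union> B \<Longrightarrow>
      commutator G b c \<otimes> y = y \<otimes> commutator G b c"
    and not_norm: "\<not> (\<forall>b \<in> B. \<forall>a \<in> A. b \<otimes> a \<otimes> inv b \<in> A)"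
  shows "\<exists>A' \<in> largest_abelian G E. A \<inter> B \<subset> A' \<inter> B \<and>
    (\<forall>y \<in> A'. \<forall>a \<in> A. y \<otimes> a \<otimes> inv y \<in> A)"
proof -
  have AG: "subgroup A G" "A \<subseteq> E" and Acomm: "\<And>x y. x \<in> A \<Longrightarrow> y \<in> A \<Longrightarrow> x \<otimes> y = y \<otimes> x"
    using A by (auto simp: largest_abelian_def abelian_subgroups_iff)
  have EG: "subgroup E G" using E by (simp add: p_subgroup_def)
  have Ac: "a \<in> carrier G" if "a \<in> A" for a using AG(1) that by (rule subgroup.mem_carrier)
  have Bc: "a \<in> carrier G" if "a \<in> B" for a using B(1) that by (rule subgroup.mem_carrier)
  have pB: "p_subgroup p B G" by (rule p_subgroup_mono[OF p E B])
  have finA: "finite A" using subgroup.subset[OF AG(1)] fin by (rule finite_subset)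
  define N where "N = {b \<in> B. \<forall>a \<in> A. b \<otimes> a \<otimes> inv b \<in> A}"
  have NS: "subgroup N G"
    unfolding N_def by (rule conj_stabilizer_subgroup[OF B(1) finA subgroup.subset[OF AG(1)]])
  have NB: "N \<subseteq> B" by (auto simp: N_def)
  have self_norm: "a \<otimes> c \<otimes> inv a \<in> A" if "a \<in> A" "c \<in> A" for a c
    using that subgroup.m_closed[OF AG(1)] subgroup.m_inv_closed[OF AG(1)] by simp
  have normN: "a \<otimes> n \<otimes> inv a \<in> N" if a: "a \<in> A" and n: "n \<in> N" for a n
  proof -
    have "(a \<otimes> n \<otimes> inv a) \<otimes> c \<otimes> inv (a \<otimes> n \<otimes> inv a) \<in> A" if c: "c \<in> A" for c
    proof -
      have "(a \<otimes> n \<otimes> inv a) \<otimes> c \<otimes> inv (a \<otimes> n \<otimes> inv a)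
          = a \<otimes> (n \<otimes> (inv a \<otimes> c \<otimes> inv (inv a)) \<otimes> inv n) \<otimes> inv a"
        using a n c Ac Bc NB by (auto simp: word_simps subset_iff)
      moreover have "inv a \<otimes> c \<otimes> inv (inv a) \<in> A"
        using self_norm c subgroup.m_inv_closed[OF AG(1) a] by blast
      ultimately show ?thesis using n a self_norm by (simp add: N_def)
    qed
    then show ?thesis using normB a n by (simp add: N_def)
  qed
  have meetN: "A \<inter> B \<subseteq> N" using self_norm by (auto simp: N_def)
  define H where "H = A <#> N"
  define X where "X = A <#> B"
  have HS: "subgroup H G" unfolding H_def by (rule set_mult_subgroup[OF AG(1) NS normN])
  have XS: "subgroup X G" unfolding X_def by (rule set_mult_subgroup[OF AG(1) B(1) normB])
  have HI: "a \<otimes> n \<in> H" if "a \<in> A" "n \<in> N" for a n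
    using that by (auto simp: H_def set_mult_def)
  have AH: "A \<subseteq> H" using HI[OF _ subgroup.one_closed[OF NS]] Ac by fastforce
  have NH: "N \<subseteq> H" using HI[OF subgroup.one_closed[OF AG(1)]] Bc NB by fastforce
  have HB: "h \<in> N" if "h \<in> H" "h \<in> B" for h
  proof -
    obtain a n where an: "a \<in> A" "n \<in> N" "h = a \<otimes> n" using \<open>h \<in> H\<close> by (auto simp: H_def set_mult_def)
    then have "h \<otimes> inv n = a" using Ac Bc NB by (auto simp: word_simps subset_iff)
    moreover have "h \<otimes> inv n \<in> B"
      using that(2) an(2) NB B(1) by (auto simp: subgroup.m_closed subgroup.m_inv_closed)
    ultimately have "a \<in> N" using an(1) meetN by auto
    then show ?thesis using an NS by (simp add: subgroup.m_closed)
  qed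
  have "X \<subseteq> E" using AG(2) B(2) EG by (auto simp: X_def set_mult_def intro: subgroup.m_closed)
  then have pX: "p_subgroup p X G" by (intro p_subgroup_mono[OF p E XS])
  have "H \<subset> X"
  proof -
    have "H \<subseteq> X" using NB by (auto simp: H_def X_def set_mult_def)
    moreover obtain b where b: "b \<in> B" "b \<notin> N" using not_norm by (auto simp: N_def)
    moreover have "b \<in> X"
      using b(1) subgroup.one_closed[OF AG(1)] Bc unfolding X_def set_mult_def by force
    ultimately show ?thesis using HB by blast
  qed
  then obtain y where y: "y \<in> X - H" "\<forall>h \<in> H. y \<otimes> h \<otimes> inv y \<in> H"
    using p_subgroup_normalizer_grows[OF p fin pX HS] by blast
  \<comment> \<open>Dropping the factor \<open>a0 \<in> A\<close> from \<open>y\<close> does not affect the property; the inverse only adapts to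
    the convention \<open>[x,a] = inv x \<otimes> inv a \<otimes> x \<otimes> a\<close>.\<close>
  then obtain a0 x0 where ax: "a0 \<in> A" "x0 \<in> B" "y = a0 \<otimes> x0" by (auto simp: X_def set_mult_def)
  define x where "x = inv x0"
  have x: "x \<in> B" using ax(2) B(1) by (simp add: x_def subgroup.m_inv_closed)
  have xc: "x \<in> carrier G" using Bc x by simp
  have xN: "x \<notin> N"
  proof
    assume "x \<in> N"
    then have "inv x \<in> N" using NS by (rule subgroup.m_inv_closed[rotated])
    then have "y \<in> H" using HI ax Bc by (simp add: x_def)
    then show False using y(1) by blast
  qed
  have kN: "commutator G x a \<in> N" if a: "a \<in> A" for a
  proof -
    have ia: "inv a \<in> A" using AG(1) a by (simp add: subgroup.m_inv_closed)
    have "inv a0 \<otimes> (y \<otimes> inv a \<otimes> inv y) \<otimes> a0 \<in> H"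
      using y(2) AH ia ax(1) HS by (auto simp: subgroup.m_closed subgroup.m_inv_closed subset_iff)
    then have "inv a0 \<otimes> (y \<otimes> inv a \<otimes> inv y) \<otimes> a0 \<otimes> a \<in> H"
      using AH a HS by (auto simp: subgroup.m_closed subset_iff)
    moreover have "inv a0 \<otimes> (y \<otimes> inv a \<otimes> inv y) \<otimes> a0 \<otimes> a = commutator G x a"
      using ax a Ac Bc by (simp add: x_def commutator_def word_simps)
    ultimately have "commutator G x a \<in> H" by simp
    moreover have "commutator G x a \<in> B"
    proof -
      have "commutator G x a = inv x \<otimes> (inv a \<otimes> x \<otimes> inv (inv a))"
        using xc Ac[OF a] by (simp add: commutator_def word_simps)
      then show ?thesis using normB[OF ia x] x B(1) by (simp add: subgroup.m_closed subgroup.m_inv_closed)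
    qed
    ultimately show ?thesis by (rule HB)
  qed
  have normA: "commutator G x a \<otimes> c \<otimes> inv (commutator G x a) \<in> A" if "a \<in> A" "c \<in> A" for a c
    using kN[OF that(1)] that(2) by (simp add: N_def)
  note commute = class_two_commutators_commute[OF p odd pB AG(1) finA Acomm normB central x normA]
  define C where "C = {c \<in> A. \<forall>a \<in> A. c \<otimes> commutator G x a = commutator G x a \<otimes> c}"
  define A' where "A' = generate G (commutator G x ` A \<union> C)"
  have A': "A' \<in> largest_abelian G E"
    unfolding A'_def C_def
    by (rule thompson_replacement_step[OF fin EG A xc]) (use kN NB B(2) commute(2) in auto)
  have "A \<inter> B \<subseteq> C" using commute(1) by (auto simp: C_def)
  then have "A \<inter> B \<subseteq> A' \<inter> B" by (auto simp: A'_def intro: generate.incl)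
  moreover have "\<exists>a \<in> A. commutator G x a \<notin> A"
  proof (rule ccontr)
    assume "\<not> ?thesis"
    then have *: "commutator G x a \<in> A" if "a \<in> A" for a using that by blast
    have "inv x \<otimes> a \<otimes> inv (inv x) \<in> A" if a: "a \<in> A" for a
    proof -
      have "inv x \<otimes> a \<otimes> inv (inv x) = commutator G x (inv a) \<otimes> a"
        using xc Ac[OF a] by (simp add: commutator_def word_simps)
      then show ?thesis using *[of "inv a"] a AG(1) by (simp add: subgroup.m_closed subgroup.m_inv_closed)
    qed
    then have "inv x \<in> N" using x B(1) by (simp add: N_def subgroup.m_inv_closed)
    then show False using xN xc NS by (metis inv_inv subgroup.m_inv_closed)
  qed
  then obtain a where "a \<in> A" "commutator G x a \<notin> A" by blast
  then have "commutator G x a \<in> A' \<inter> B - A \<inter> B"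
    using kN NB by (auto simp: A'_def intro: generate.incl)
  moreover have "y \<otimes> a \<otimes> inv y \<in> A" if "y \<in> A'" "a \<in> A" for y a
  proof -
    have "subgroup {y \<in> carrier G. \<forall>a\<in>A. y \<otimes> a \<otimes> inv y \<in> A} G"
      by (rule conj_stabilizer_subgroup[OF subgroup_self finA subgroup.subset[OF AG(1)]])
    moreover have "commutator G x ` A \<union> C \<subseteq> {y \<in> carrier G. \<forall>a\<in>A. y \<otimes> a \<otimes> inv y \<in> A}"
      using normA self_norm Ac xc by (auto simp: C_def)
    ultimately have "A' \<subseteq> {y \<in> carrier G. \<forall>a\<in>A. y \<otimes> a \<otimes> inv y \<in> A}"
      unfolding A'_def by (intro generate_subgroup_incl)
    then show ?thesis using that by blast
  qed
  ultimately show ?thesis using A' by blast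
qed

section \<open>The center of the Thompson subgroup and p-stability\<close>

lemma J_o_eq_generate: "J_o G E = generate G (\<Union> (largest_abelian G E))"
  by (simp add: J_o_def largest_abelian_def)

lemma (in group) largest_abelian_subset:
  assumes "A \<in> largest_abelian G E"
  shows "A \<subseteq> carrier G" "A \<subseteq> E"
  using assms by (auto simp: largest_abelian_def abelian_subgroups_iff dest: subgroup.mem_carrier)

lemma (in group) J_o_subgroup: "subgroup (J_o G E) G"
  unfolding J_o_eq_generate using largest_abelian_subset by (intro generate_is_subgroup) blast

lemma (in group) J_o_subset: "subgroup E G \<Longrightarrow> J_o G E \<subseteq> E"
  unfolding J_o_eq_generate using largest_abelian_subset by (intro generate_subgroup_incl) blast

lemma (in group) largest_abelian_subset_J_o: "A \<in> largest_abelian G E \<Longrightarrow> A \<subseteq> J_o G E"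
  unfolding J_o_eq_generate by (auto intro: generate.incl)

lemma (in group) center_of_subgroup:
  assumes "subgroup J G"
  shows "subgroup (center_of G J) G"
proof -
  have "center_of G J = J \<inter> centralizer G J"
    using assms by (auto simp: center_of_def centralizer_def dest: subgroup.mem_carrier)
  then show ?thesis
    using subgroups_Inter_pair[OF assms centralizer_subgroup[OF subgroup.subset[OF assms]]] by simp
qed

lemma (in group) center_J_o_subset_largest_abelian:
  assumes "finite (carrier G)" "subgroup E G" "A \<in> largest_abelian G E"
  shows "center_of G (J_o G E) \<subseteq> A"
  using largest_abelian_self_centralizing[OF assms] J_o_subset[OF assms(2)]
    largest_abelian_subset_J_o[OF assms(3)] by (auto simp: center_of_def)

text \<open>\<open>Z(J(E))\<close> is characteristic in \<open>E\<close>: conjugation by \<open>g\<close> permutes the largest abelian subgroups of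
\<open>E\<close>.\<close>

lemma (in group) center_J_o_conj_closed:
  assumes fin: "finite (carrier G)" and g: "g \<in> carrier G"
    and inv_E: "\<And>x. x \<in> E \<Longrightarrow> g \<otimes> x \<otimes> inv g \<in> E" and z: "z \<in> center_of G (J_o G E)"
  shows "g \<otimes> z \<otimes> inv g \<in> center_of G (J_o G E)"
proof -
  let ?c = "\<lambda>x. g \<otimes> x \<otimes> inv g" and ?J = "J_o G E"
  have Jc: "x \<in> carrier G" if "x \<in> ?J" for x using J_o_subgroup that by (rule subgroup.mem_carrier)
  have "?c ` A \<in> largest_abelian G E" if A: "A \<in> largest_abelian G E" for A
  proof -
    have A': "subgroup A G" "A \<subseteq> E" "\<And>x y. x \<in> A \<Longrightarrow> y \<in> A \<Longrightarrow> x \<otimes> y = y \<otimes> x"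
      using A by (auto simp: largest_abelian_def abelian_subgroups_iff)
    have Ac: "x \<in> carrier G" if "x \<in> A" for x using A'(1) that by (rule subgroup.mem_carrier)
    have mult: "?c x \<otimes> ?c y = ?c (x \<otimes> y)" if "x \<in> A" "y \<in> A" for x y
      using that Ac g by (simp add: word_simps)
    have "card (?c ` A) = card A" using Ac g by (intro card_image inj_onI) simp
    moreover have "subgroup (?c ` A) G"
      by (rule group_hom.subgroup_img_is_subgroup[OF conj_hom[OF g] A'(1)])
    moreover have "?c ` A \<subseteq> E" using inv_E A'(2) by blast
    moreover have "\<forall>u \<in> ?c ` A. \<forall>v \<in> ?c ` A. u \<otimes> v = v \<otimes> u"
    proof (intro ballI, elim imageE)
      fix u v x y assume "u = ?c x" "v = ?c y" "x \<in> A" "y \<in> A"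
      then show "u \<otimes> v = v \<otimes> u" by (simp only: mult A'(3)[of x y])
    qed
    ultimately have "?c ` A \<in> abelian_subgroups G E"
      unfolding abelian_subgroups_iff by (intro conjI)
    then show ?thesis using A \<open>card (?c ` A) = card A\<close> by (simp add: largest_abelian_def)
  qed
  then have "?c ` \<Union> (largest_abelian G E) \<subseteq> \<Union> (largest_abelian G E)" by blast
  then have "generate G (?c ` \<Union> (largest_abelian G E)) \<subseteq> ?J"
    unfolding J_o_eq_generate by (rule mono_generate)
  moreover have "\<Union> (largest_abelian G E) \<subseteq> carrier G"
    by (rule Union_least) (rule largest_abelian_subset(1))
  then have "generate G (?c ` \<Union> (largest_abelian G E)) = ?c ` ?J"
    unfolding J_o_eq_generate by (rule group_hom.generate_img[OF conj_hom[OF g]])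
  ultimately have "?c ` ?J \<subseteq> ?J" by (simp only:)
  then have img: "?c ` ?J = ?J"
    by (intro conj_image_eq ballI g subgroup.subset[OF J_o_subgroup]
        finite_subset[OF subgroup.subset[OF J_o_subgroup] fin]) blast
  have zJ: "z \<in> ?J" "\<And>x. x \<in> ?J \<Longrightarrow> z \<otimes> x = x \<otimes> z" using z by (auto simp: center_of_def)
  have "?c z \<otimes> u = u \<otimes> ?c z" if u: "u \<in> ?J" for u
  proof -
    have "u \<in> ?c ` ?J" using u by (simp only: img)
    then obtain v where v: "v \<in> ?J" "u = ?c v" by blast
    have car: "v \<in> carrier G" "z \<in> carrier G" using v(1) zJ(1) by (auto intro: Jc)
    have "?c z \<otimes> ?c v = ?c (z \<otimes> v)" using car g by (simp add: word_simps)
    also have "\<dots> = ?c (v \<otimes> z)" using zJ(2) v by simp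
    also have "\<dots> = ?c v \<otimes> ?c z" using car g by (simp add: word_simps)
    finally show ?thesis using v by simp
  qed
  then show ?thesis using img zJ(1) by (auto simp: center_of_def)
qed

lemma (in group) normalizer_of_normal:
  assumes "Q \<lhd> G"
  shows "normalizer G Q = carrier G"
proof -
  interpret Q: normal Q G by (rule assms)
  have "g <# Q #> inv g = Q" if "g \<in> carrier G" for g
    using Q.coset_eq that by (simp add: coset_mult_assoc Q.subset flip: Q.coset_eq)
  then show ?thesis using Q.subset by (auto simp: normalizer_def stabilizer_def)
qed

lemma (in group) centralizer_of_normal:
  assumes "Q \<lhd> G"
  shows "centralizer G Q \<lhd> G"
proof -
  interpret Q: normal Q G by (rule assms)
  have "g \<otimes> c \<otimes> inv g \<in> centralizer G Q" if g: "g \<in> carrier G" and c: "c \<in> centralizer G Q" for g c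
  proof -
    have cc: "c \<in> carrier G" using c by (simp add: centralizer_def)
    have "(g \<otimes> c \<otimes> inv g) \<otimes> x = x \<otimes> (g \<otimes> c \<otimes> inv g)" if x: "x \<in> Q" for x
    proof -
      have "c \<otimes> (inv g \<otimes> x \<otimes> g) = (inv g \<otimes> x \<otimes> g) \<otimes> c"
        using Q.inv_op_closed1[OF g x] c by (simp add: centralizer_def)
      then have "g \<otimes> (c \<otimes> (inv g \<otimes> x \<otimes> g)) \<otimes> inv g = g \<otimes> ((inv g \<otimes> x \<otimes> g) \<otimes> c) \<otimes> inv g"
        by simp
      then show ?thesis using g cc Q.mem_carrier[OF x] by (simp add: word_simps)
    qed
    then show ?thesis using g cc by (simp add: centralizer_def)
  qed
  then show ?thesis
    using centralizer_subgroup[OF Q.subset] by (intro normal_invI) auto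
qed

text \<open>The group \<open>K\<close> serves to verify \<open>[Q,g,g] = 1\<close>: it contains \<open>[Q,g]\<close> and commutes with \<open>g\<close>.\<close>

lemma (in group) p_stable_normal:
  assumes stable: "p_stable p G" and Q: "Q \<lhd> G" "p_subgroup p Q G"
    and g: "g \<in> carrier G" and K: "subgroup K G"
    and QgK: "\<And>x. x \<in> Q \<Longrightarrow> commutator G x g \<in> K" and Kg: "\<And>k. k \<in> K \<Longrightarrow> k \<otimes> g = g \<otimes> k"
  shows "g <# centralizer G Q \<in> p_core p (G Mod centralizer G Q)"
proof -
  have "commutator_subgroup G Q g \<subseteq> K"
    unfolding commutator_subgroup_def using QgK by (intro generate_subgroup_incl[OF _ K]) blast
  then have "commutator G k g = \<one>" if "k \<in> commutator_subgroup G Q g" for k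
    using that Kg[of k] g subgroup.mem_carrier[OF K, of k] by (auto simp: commutator_eq_one_iff)
  then have "commutator_subgroup G (commutator_subgroup G Q g) g \<subseteq> {\<one>}"
    unfolding commutator_subgroup_def[of G "commutator_subgroup G Q g"]
    by (intro generate_subgroup_incl triv_subgroup) blast
  then have "commutator_subgroup G (commutator_subgroup G Q g) g = {\<one>}"
    unfolding commutator_subgroup_def[of G "commutator_subgroup G Q g"]
    using generate.one by blast
  then show ?thesis
    using stable Q(2) g normalizer_of_normal[OF Q(1)] by (auto simp: p_stable_def)
qed

lemma finite_obtains_max:
  fixes f :: "'a \<Rightarrow> nat"
  assumes "finite S" "S \<noteq> {}"
  obtains A where "A \<in> S" "\<And>A'. A' \<in> S \<Longrightarrow> f A' \<le> f A"
proof -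
  have "Max (f ` S) \<in> f ` S" using assms by (intro Max_in) auto
  then obtain A where "A \<in> S" "f A = Max (f ` S)" by auto
  then show ?thesis using that assms(1) by (metis Max_ge finite_imageI imageI)
qed

text \<open>Strong closure enters by showing that \<open>N\<^sub>G(P \<inter> L)\<close> normalizes \<open>E \<inter> L\<close>; the replacement theorem
applies inside \<open>E\<close> because \<open>B \<le> E\<close>.\<close>

theorem (in group) normal_meets_center_J_o:
  assumes p: "Factorial_Ring.prime p" and odd: "odd p" and fin: "finite (carrier G)"
    and stable: "p_stable p G" and P: "sylow_subgroup p P G"
    and E: "subgroup E G" "E \<subseteq> P"
    and closed: "\<And>x g. x \<in> E \<Longrightarrow> g \<in> carrier G \<Longrightarrow> g \<otimes> x \<otimes> inv g \<in> P \<Longrightarrow> g \<otimes> x \<otimes> inv g \<in> E"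
  shows "B \<lhd> G \<Longrightarrow> B \<subseteq> E \<Longrightarrow> B \<inter> center_of G (J_o G E) \<lhd> G"
proof (induction "card B" arbitrary: B rule: less_induct)
  case less
  let ?J = "J_o G E"
  let ?Z = "center_of G ?J"
  note B = less.prems(1) and BE = less.prems(2)
  interpret B: normal B G by (rule B)
  have PG: "subgroup P G" using P by (simp add: sylow_subgroup_def)
  have pE: "p_subgroup p E G"
    using p_subgroup_mono[OF p _ E] P sylow_subgroup_iff[OF p fin] by blast
  have pB: "p_subgroup p B G" by (rule p_subgroup_mono[OF p pE B.subgroup_axioms BE])
  have finB: "finite B" using B.subset fin by (rule finite_subset)
  have Ec: "x \<in> carrier G" if "x \<in> E" for x using E(1) that by (rule subgroup.mem_carrier)
  have JS: "subgroup ?J G" and JE: "?J \<subseteq> E" by (rule J_o_subgroup) (rule J_o_subset[OF E(1)])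
  have ZS: "subgroup ?Z G" by (rule center_of_subgroup[OF JS])
  have ZJ: "z \<otimes> x = x \<otimes> z" if "z \<in> ?Z" "x \<in> ?J" for z x using that by (simp add: center_of_def)
  have ZsubJ: "?Z \<subseteq> ?J" by (auto simp: center_of_def)
  have Zc: "z \<in> carrier G" if "z \<in> ?Z" for z using ZS that by (rule subgroup.mem_carrier)
  have Z_conj: "x \<otimes> z \<otimes> inv x \<in> ?Z" if "x \<in> E" "z \<in> ?Z" for x z
    using that Ec subgroup.m_closed[OF E(1)] subgroup.m_inv_closed[OF E(1)]
    by (intro center_J_o_conj_closed[OF fin]) auto
  let ?U = "\<Union>g\<in>carrier G. (\<lambda>y. g \<otimes> y \<otimes> inv g) ` (B \<inter> ?Z)"
  define B1 where "B1 = generate G ?U"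
  have U: "?U \<subseteq> B" using B.inv_op_closed2 by blast
  have BZ_U: "B \<inter> ?Z \<subseteq> ?U"
  proof
    fix y assume "y \<in> B \<inter> ?Z"
    then have "y = \<one> \<otimes> y \<otimes> inv \<one>" using Zc by simp
    then show "y \<in> ?U" using \<open>y \<in> B \<inter> ?Z\<close> by blast
  qed
  have B1: "B1 \<lhd> G"
    unfolding B1_def
  proof (rule normal_generateI)
    show "?U \<subseteq> carrier G" using U B.subset by blast
    show "g \<otimes> u \<otimes> inv g \<in> ?U" if u: "u \<in> ?U" and g: "g \<in> carrier G" for u g
    proof -
      obtain h y where "h \<in> carrier G" "y \<in> B \<inter> ?Z" "u = h \<otimes> y \<otimes> inv h" using u by blast
      moreover from this have "g \<otimes> u \<otimes> inv g = (g \<otimes> h) \<otimes> y \<otimes> inv (g \<otimes> h)"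
        using g Zc by (simp add: word_simps)
      ultimately show ?thesis using g by blast
    qed
  qed
  have B1_B: "B1 \<subseteq> B" unfolding B1_def by (rule generate_subgroup_incl[OF U B.subgroup_axioms])
  have BZ_B1: "B \<inter> ?Z \<subseteq> B1" unfolding B1_def using BZ_U by (auto intro: generate.incl)
  show ?case
  proof (cases "B1 = B")
    case False
    then have "B1 \<inter> ?Z \<lhd> G"
      using B1_B BE B1 finB by (intro less.hyps) (auto intro: psubset_card_mono)
    moreover have "B1 \<inter> ?Z = B \<inter> ?Z" using B1_B BZ_B1 by blast
    ultimately show ?thesis by simp
  next
    case True
    then have gen: "generate G ?U = B" by (simp add: B1_def)
    show ?thesis
    proof (cases "B = {\<one>}")
      case True
      then have "B \<inter> ?Z = {\<one>}" using subgroup.one_closed[OF ZS] by auto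
      then show ?thesis using one_is_normal by simp
    next
      case False
      let ?V = "{commutator G b c | b c. b \<in> B \<and> c \<in> B}"
      \<comment> \<open>The derived subgroup of \<open>B\<close> is smaller than \<open>B\<close>, so the induction hypothesis applies to it.\<close>
      define K where "K = generate G ?V"
      obtain M where M: "subgroup M G" "M \<subset> B" "\<forall>b\<in>B. \<forall>c\<in>B. commutator G b c \<in> M"
        using p_group_commutators_in_proper_subgroup[OF p fin pB False] by blast
      have KM: "K \<subseteq> M" unfolding K_def using M by (intro generate_subgroup_incl) auto
      have K: "K \<lhd> G"
        unfolding K_def
      proof (rule normal_generateI)
        show "?V \<subseteq> carrier G" using B.mem_carrier by auto
        show "g \<otimes> v \<otimes> inv g \<in> ?V" if v: "v \<in> ?V" and g: "g \<in> carrier G" for v g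
        proof -
          obtain b c where bc: "b \<in> B" "c \<in> B" "v = commutator G b c" using v by blast
          then have "g \<otimes> v \<otimes> inv g = commutator G (g \<otimes> b \<otimes> inv g) (g \<otimes> c \<otimes> inv g)"
            using commutator_conj[of b c "inv g"] g by simp
          then show ?thesis using bc B.inv_op_closed2[OF g] by blast
        qed
      qed
      define W where "W = K \<inter> ?Z"
      have W: "W \<lhd> G"
        unfolding W_def using KM M BE K finB by (intro less.hyps psubset_card_mono) auto
      interpret W: normal W G by (rule W)
      have WZ: "W \<subseteq> ?Z" by (auto simp: W_def)
      have comm_Z: "commutator G y b \<in> W" if y: "y \<in> B \<inter> ?Z" and b: "b \<in> B" for y b
      proof -
        have "inv b \<otimes> y \<otimes> inv (inv b) \<in> ?Z" using y b BE by (intro Z_conj) auto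
        then have "inv y \<otimes> (inv b \<otimes> y \<otimes> inv (inv b)) \<in> ?Z"
          using y ZS by (simp add: subgroup.m_closed subgroup.m_inv_closed)
        moreover have "inv y \<otimes> (inv b \<otimes> y \<otimes> inv (inv b)) = commutator G y b"
          using y b Zc by (simp add: commutator_def word_simps)
        moreover have "commutator G y b \<in> K"
          unfolding K_def using y b by (intro generate.incl) blast
        ultimately show ?thesis by (simp add: W_def)
      qed
      \<comment> \<open>As \<open>W\<close> is normal in \<open>G\<close>, the previous fact passes to the conjugates of \<open>B \<inter> Z\<close> and to \<open>B\<close>.\<close>
      have comm_W: "commutator G b c \<in> W" if b: "b \<in> B" and c: "c \<in> B" for b c
      proof -
        let ?S = "{y \<in> B. \<forall>b\<in>B. commutator G y b \<in> W}"
        have S: "subgroup ?S G"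
        proof (rule subgroupI)
          show "?S \<subseteq> carrier G" using B.subset by blast
          have "\<one> \<in> ?S" using W.one_closed by (simp add: commutator_def)
          then show "?S \<noteq> {}" by blast
          show "inv u \<in> ?S" if u: "u \<in> ?S" for u
          proof -
            have "commutator G (inv u) b \<in> W" if "b \<in> B" for b
            proof -
              have "commutator G (inv u) b = u \<otimes> inv (commutator G u b) \<otimes> inv u"
                using u that by (simp add: commutator_def word_simps)
              then show ?thesis using u that W.inv_op_closed2 by simp
            qed
            then show ?thesis using u by simp
          qed
          show "u \<otimes> v \<in> ?S" if u: "u \<in> ?S" and v: "v \<in> ?S" for u v
          proof -
            have "commutator G (u \<otimes> v) b \<in> W" if "b \<in> B" for b
            proof -
              have "commutator G (u \<otimes> v) b = (inv v \<otimes> commutator G u b \<otimes> v) \<otimes> commutator G v b"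
                using u v that by (simp add: commutator_def word_simps)
              then show ?thesis using u v that W.inv_op_closed1 by simp
            qed
            then show ?thesis using u v by simp
          qed
        qed
        have "?U \<subseteq> ?S"
        proof
          fix u assume "u \<in> ?U"
          then obtain g y where u: "g \<in> carrier G" "y \<in> B \<inter> ?Z" "u = g \<otimes> y \<otimes> inv g" by blast
          have "commutator G u b \<in> W" if "b \<in> B" for b
          proof -
            have "commutator G u b = g \<otimes> commutator G y (inv g \<otimes> b \<otimes> g) \<otimes> inv g"
              using u that Zc by (simp add: commutator_def word_simps)
            then show ?thesis
              using comm_Z[OF u(2) B.inv_op_closed1[OF u(1) that]] W.inv_op_closed2[OF u(1)] by simp
          qed
          then show "u \<in> ?S" using \<open>u \<in> ?U\<close> U by blast
        qed
        from generate_subgroup_incl[OF this S] have "B \<subseteq> ?S" by (simp only: gen)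
        then show ?thesis using b c by blast
      qed
      \<comment> \<open>\<open>Z\<close> is abelian, so \<open>W\<close> commutes with \<open>B \<inter> Z\<close> and, being normal, with its conjugates.\<close>
      have W_central: "w \<otimes> b = b \<otimes> w" if w: "w \<in> W" and b: "b \<in> B" for w b
      proof -
        have U_W: "u \<otimes> w = w \<otimes> u" if uU: "u \<in> ?U" and w: "w \<in> W" for u w
        proof -
          obtain g y where u: "g \<in> carrier G" "y \<in> B \<inter> ?Z" "u = g \<otimes> y \<otimes> inv g" using uU by blast
          have "inv g \<otimes> w \<otimes> g \<in> W" by (rule W.inv_op_closed1[OF u(1) w])
          then have "y \<otimes> (inv g \<otimes> w \<otimes> g) = (inv g \<otimes> w \<otimes> g) \<otimes> y"
            using ZJ u(2) WZ ZsubJ by blast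
          then have "g \<otimes> (y \<otimes> (inv g \<otimes> w \<otimes> g)) \<otimes> inv g = g \<otimes> ((inv g \<otimes> w \<otimes> g) \<otimes> y) \<otimes> inv g"
            by simp
          then show ?thesis using u W.mem_carrier[OF w] Zc by (simp add: word_simps)
        qed
        have "?U \<subseteq> carrier G" using U B.subset by blast
        moreover have "b \<in> generate G ?U" using b by (simp only: gen)
        ultimately have "b \<otimes> w = w \<otimes> b"
          using generate.incl[OF w] by (intro generate_commute[OF _ W.subset U_W])
        then show ?thesis by (rule sym)
      qed
      have central: "commutator G b c \<otimes> y = y \<otimes> commutator G b c"
        if A: "A \<in> largest_abelian G E" and b: "b \<in> B" and c: "c \<in> B" and y: "y \<in> A \<union> B" for A b c y
      proof -
        have w: "commutator G b c \<in> W" by (rule comm_W[OF b c])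
        show ?thesis
        proof (cases "y \<in> B")
          case True
          then show ?thesis by (rule W_central[OF w])
        next
          case False
          then have "y \<in> ?J" using y largest_abelian_subset_J_o[OF A] by blast
          then show ?thesis using ZJ w WZ by blast
        qed
      qed
      define C where "C = centralizer G B"
      define L where "L = \<Union> (p_core p (G Mod C))"
      have C: "C \<lhd> G" unfolding C_def by (rule centralizer_of_normal[OF B])
      note L = normal_preimage_p_core[OF p fin C, folded L_def]
      have LS: "subgroup L G" by (rule normal_imp_subgroup[OF L(1)])
      have normalized_in_L: "A \<subseteq> L"
        if A: "A \<in> largest_abelian G E" and norm: "\<forall>b \<in> B. \<forall>a \<in> A. b \<otimes> a \<otimes> inv b \<in> A" for A
      proof
        fix a assume a: "a \<in> A"
        have A': "subgroup A G" "\<And>x y. x \<in> A \<Longrightarrow> y \<in> A \<Longrightarrow> x \<otimes> y = y \<otimes> x"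
          using A by (auto simp: largest_abelian_def abelian_subgroups_iff)
        have ac: "a \<in> carrier G" using A'(1) a by (rule subgroup.mem_carrier)
        have "commutator G b a \<in> A" if b: "b \<in> B" for b
        proof -
          have "inv b \<otimes> inv a \<otimes> inv (inv b) \<in> A"
            using norm B.m_inv_closed[OF b] subgroup.m_inv_closed[OF A'(1) a] by blast
          then have "inv b \<otimes> inv a \<otimes> inv (inv b) \<otimes> a \<in> A" using a A'(1) by (simp add: subgroup.m_closed)
          then show ?thesis using b ac by (simp add: commutator_def word_simps)
        qed
        then have "a <# C \<in> p_core p (G Mod C)"
          unfolding C_def using a A' by (intro p_stable_normal[OF stable B pB ac A'(1)]) auto
        then show "a \<in> L" by (rule L(4)[OF ac])
      qed
      have finS: "finite (largest_abelian G E)"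
        using finite_abelian_subgroups[OF fin, of E] by (auto simp: largest_abelian_def)
      have replace: "\<exists>A' \<in> largest_abelian G E. card (A \<inter> B) < card (A' \<inter> B) \<and>
          (\<forall>y \<in> A'. \<forall>a \<in> A. y \<otimes> a \<otimes> inv y \<in> A)"
        if A: "A \<in> largest_abelian G E" and not_norm: "\<not> (\<forall>b \<in> B. \<forall>a \<in> A. b \<otimes> a \<otimes> inv b \<in> A)"
        for A
      proof -
        have norm: "a \<otimes> b \<otimes> inv a \<in> B" if "a \<in> A" "b \<in> B" for a b
          using that B.inv_op_closed2 largest_abelian_subset(1)[OF A] by blast
        have "\<exists>A' \<in> largest_abelian G E. A \<inter> B \<subset> A' \<inter> B \<and>
            (\<forall>y \<in> A'. \<forall>a \<in> A. y \<otimes> a \<otimes> inv y \<in> A)"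
          by (rule glauberman_replacement[OF p odd fin pE A B.subgroup_axioms BE norm central[OF A]
              not_norm])
        then show ?thesis using finB by (meson finite_Int psubset_card_mono)
      qed
      obtain A0 where A0: "A0 \<in> largest_abelian G E"
        and "\<And>A'. A' \<in> largest_abelian G E \<Longrightarrow> card (A' \<inter> B) \<le> card (A0 \<inter> B)"
        using finite_obtains_max[OF finS largest_abelian_exists[OF fin E(1)], of "\<lambda>A. card (A \<inter> B)"]
        by blast
      then have A0L: "A0 \<subseteq> L"
        using replace[OF A0] normalized_in_L[OF A0] by (meson leD)
      define T where "T = P \<inter> L"
      have T: "sylow_subgroup p T (G\<lparr>carrier := L\<rparr>)"
        unfolding T_def by (rule sylow_of_normal_subgroup[OF p fin P L(1)])
      define E1 where "E1 = E \<inter> L"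
      have E1: "subgroup E1 G" unfolding E1_def by (rule subgroups_Inter_pair[OF E(1) LS])
      have largest_E1: "A \<in> largest_abelian G E1 \<longleftrightarrow> A \<in> largest_abelian G E \<and> A \<subseteq> L" for A
      proof -
        have ab: "abelian_subgroups G E1 = {A \<in> abelian_subgroups G E. A \<subseteq> L}"
          by (auto simp: E1_def abelian_subgroups_iff)
        then have "A0 \<in> abelian_subgroups G E1" using A0 A0L by (simp add: largest_abelian_def)
        then show ?thesis
          using A0 unfolding largest_abelian_iff[OF fin] ab by (auto intro: order_trans)
      qed
      define Z1 where "Z1 = center_of G (J_o G E1)"
      have Z1S: "subgroup Z1 G" unfolding Z1_def by (rule center_of_subgroup[OF J_o_subgroup])
      have "J_o G E1 \<subseteq> ?J"
        unfolding J_o_eq_generate using largest_E1 by (intro mono_generate) blast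
      moreover have "A0 \<subseteq> J_o G E1" using largest_abelian_subset_J_o largest_E1 A0 A0L by blast
      moreover have "?Z \<subseteq> A0" by (rule center_J_o_subset_largest_abelian[OF fin E(1) A0])
      ultimately have "z \<in> J_o G E1" "\<forall>x \<in> J_o G E1. z \<otimes> x = x \<otimes> z" if "z \<in> ?Z" for z
        using that ZJ[OF that] by blast+
      then have ZZ1: "?Z \<subseteq> Z1" unfolding Z1_def center_of_def[of G "J_o G E1"] by blast
      let ?N = "{g \<in> carrier G. \<forall>t\<in>T. g \<otimes> t \<otimes> inv g \<in> T}"
      have TS: "subgroup T G" unfolding T_def by (rule subgroups_Inter_pair[OF PG LS])
      have Tc: "T \<subseteq> carrier G" by (rule subgroup.subset[OF TS])
      have N: "subgroup ?N G"
        using finite_subset[OF Tc fin] Tc by (intro conj_stabilizer_subgroup[OF subgroup_self])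
      have Z1_inv: "g \<otimes> z \<otimes> inv g \<in> Z1" if g: "g \<in> ?N" and z: "z \<in> Z1" for g z
        unfolding Z1_def
      proof (rule center_J_o_conj_closed[OF fin])
        show "g \<otimes> x \<otimes> inv g \<in> E1" if "x \<in> E1" for x
          using that g closed[of x g] E(2) by (auto simp: E1_def T_def)
      qed (use g z in \<open>auto simp: Z1_def\<close>)
      have TC: "T <#> C = L"
      proof -
        obtain k where k: "card L = card C * p ^ k" using L(2) by blast
        have "C \<lhd> G\<lparr>carrier := L\<rparr>" by (rule normal_restrict_supergroup[OF LS C L(3)])
        moreover have "finite (carrier (G\<lparr>carrier := L\<rparr>))"
          using finite_subset[OF subgroup.subset[OF LS] fin] by simp
        moreover have "order (G\<lparr>carrier := L\<rparr>) = card C * p ^ k" using k by (simp add: order_def)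
        ultimately have "T <#>\<^bsub>G\<lparr>carrier := L\<rparr>\<^esub> C = L"
          using group.sylow_times_normal_p_index[OF subgroup_imp_group[OF LS] p _ T] by fastforce
        then show ?thesis by (simp add: set_mult_def)
      qed
      have "?U \<subseteq> Z1"
      proof
        fix u assume "u \<in> ?U"
        then obtain g y where u: "g \<in> carrier G" "y \<in> B \<inter> ?Z" "u = g \<otimes> y \<otimes> inv g" by blast
        obtain l where l: "l \<in> L" "\<forall>t\<in>T. (l \<otimes> inv g) \<otimes> t \<otimes> inv (l \<otimes> inv g) \<in> T"
          using frattini_argument[OF p fin L(1) T inv_closed[OF u(1)]] by blast
        obtain t c where tc: "t \<in> T" "c \<in> C" "l = t \<otimes> c" using l(1) TC by (auto simp: set_mult_def)
        have car: "l \<in> carrier G" "t \<in> carrier G" "c \<in> carrier G" "y \<in> carrier G"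
          using l tc Tc subgroup.mem_carrier[OF LS] u(2) by (auto simp: C_def centralizer_def)
        define n where "n = inv (l \<otimes> inv g) \<otimes> t"
        have "l \<otimes> inv g \<in> ?N" using l u car by simp
        moreover have "t \<in> ?N"
          using tc(1) car TS by (simp add: subgroup.m_closed subgroup.m_inv_closed)
        ultimately have n: "n \<in> ?N"
          unfolding n_def by (rule subgroup.m_closed[OF N subgroup.m_inv_closed[OF N]])
        \<comment> \<open>\<open>c\<close> centralizes \<open>y\<close>, so only the part \<open>n\<close> of \<open>g\<close> that normalizes \<open>T\<close> moves it.\<close>
        have "g = n \<otimes> c"
        proof -
          have "n \<otimes> c = inv (l \<otimes> inv g) \<otimes> l" using car u tc by (simp add: n_def m_assoc)
          then show ?thesis using car u by (simp add: word_simps)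
        qed
        then have "u = n \<otimes> (c \<otimes> y \<otimes> inv c) \<otimes> inv n"
          using u car n by (simp add: word_simps)
        also have "c \<otimes> y \<otimes> inv c = y"
          using tc(2) u(2) car by (auto simp: C_def centralizer_def m_assoc)
        finally show "u \<in> Z1" using Z1_inv[OF n] u(2) ZZ1 by blast
      qed
      from generate_subgroup_incl[OF this Z1S] have BZ1: "B \<subseteq> Z1" by (simp only: gen)
      show ?thesis
      proof (cases "\<forall>A \<in> largest_abelian G E. A \<subseteq> L")
        case True
        then have "largest_abelian G E1 = largest_abelian G E" using largest_E1 by blast
        then have "Z1 = ?Z" by (simp add: Z1_def J_o_eq_generate)
        then have "B \<inter> ?Z = B" using BZ1 by blast
        then show ?thesis using B by simp
      next
        case False
        \<comment> \<open>Replacing a member of \<open>?R\<close> with maximal intersection leads to a subgroup in \<open>L\<close>, thus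
          containing \<open>Z1\<close> and \<open>B\<close>; then \<open>B\<close> would normalize the member that was replaced.\<close>
        let ?R = "{A \<in> largest_abelian G E. \<not> A \<subseteq> L}"
        obtain A where A: "A \<in> ?R" and max: "\<And>A'. A' \<in> ?R \<Longrightarrow> card (A' \<inter> B) \<le> card (A \<inter> B)"
          using finite_obtains_max[of ?R "\<lambda>A. card (A \<inter> B)"] False finS by auto
        have "\<not> (\<forall>b \<in> B. \<forall>a \<in> A. b \<otimes> a \<otimes> inv b \<in> A)"
          using A normalized_in_L by blast
        then obtain A' where A': "A' \<in> largest_abelian G E" "card (A \<inter> B) < card (A' \<inter> B)"
            "\<forall>y \<in> A'. \<forall>a \<in> A. y \<otimes> a \<otimes> inv y \<in> A"
          using replace A by blast
        have "A' \<subseteq> L" using A'(1,2) max[of A'] by force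
        then have "Z1 \<subseteq> A'"
          unfolding Z1_def using A'(1) largest_E1
          by (intro center_J_o_subset_largest_abelian[OF fin E1]) blast
        then have "\<forall>b \<in> B. \<forall>a \<in> A. b \<otimes> a \<otimes> inv b \<in> A" using BZ1 A'(3) by blast
        with \<open>\<not> (\<forall>b \<in> B. _ b)\<close> show ?thesis by blast
      qed
    qed
  qed
qed

text \<open>The subgroup \<open>Z\<close> is normal and abelian in \<open>P\<close>, hence \<open>[O\<^sub>p(G),Z,Z] = 1\<close>. By \<open>p\<close>-stability \<open>Z\<close> lies
in the preimage \<open>L\<close> of \<open>O\<^sub>p(G/C)\<close> with \<open>C = C\<^sub>G(O\<^sub>p(G))\<close>. As \<open>C\<close> is a \<open>p\<close>-group, so is \<open>L\<close>, and
\<open>Z \<le> L \<le> O\<^sub>p(G)\<close>; then \<open>normal_meets_center_J_o\<close> applies to \<open>O\<^sub>p(G) \<inter> E\<close>.\<close>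

theorem (in group) center_J_o_normal:
  assumes p: "Factorial_Ring.prime p" and odd: "odd p" and fin: "finite (carrier G)"
    and stable: "p_stable p G" and P: "sylow_subgroup p P G"
    and constrained: "centralizer G (p_core p G) \<subseteq> p_core p G"
    and E: "subgroup E G" "E \<subseteq> P"
    and closed: "\<And>x g. x \<in> E \<Longrightarrow> g \<in> carrier G \<Longrightarrow> g \<otimes> x \<otimes> inv g \<in> P \<Longrightarrow> g \<otimes> x \<otimes> inv g \<in> E"
  shows "center_of G (J_o G E) \<lhd> G"
proof -
  let ?Z = "center_of G (J_o G E)" and ?V = "p_core p G"
  let ?C = "centralizer G ?V"
  define L where "L = \<Union> (p_core p (G Mod ?C))"
  interpret V: normal ?V G by (rule p_core_normal)
  have pV: "p_subgroup p ?V G" by (rule p_core_p_subgroup[OF p fin])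
  have VP: "?V \<subseteq> P" by (rule p_core_subset_sylow[OF p fin P])
  have PG: "subgroup P G" using P by (simp add: sylow_subgroup_def)
  have ZS: "subgroup ?Z G" by (rule center_of_subgroup[OF J_o_subgroup])
  have ZJ: "?Z \<subseteq> J_o G E" by (auto simp: center_of_def)
  have ZE: "?Z \<subseteq> E" using ZJ J_o_subset[OF E(1)] by blast
  have Zcomm: "x \<otimes> y = y \<otimes> x" if "x \<in> ?Z" "y \<in> ?Z" for x y
    using that unfolding center_of_def by blast
  have Z_conj: "g \<otimes> z \<otimes> inv g \<in> ?Z" if g: "g \<in> P" and z: "z \<in> ?Z" for g z
  proof (rule center_J_o_conj_closed[OF fin _ _ z])
    show gc: "g \<in> carrier G" using PG g by (rule subgroup.mem_carrier)
    show "g \<otimes> x \<otimes> inv g \<in> E" if x: "x \<in> E" for x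
      using x g E(2) PG gc by (intro closed) (auto simp: subgroup.m_closed subgroup.m_inv_closed)
  qed
  have C: "?C \<lhd> G" by (rule centralizer_of_normal[OF p_core_normal])
  note L = normal_preimage_p_core[OF p fin C, folded L_def]
  have LS: "subgroup L G" by (rule normal_imp_subgroup[OF L(1)])
  have ZL: "?Z \<subseteq> L"
  proof
    fix z assume z: "z \<in> ?Z"
    have zc: "z \<in> carrier G" using ZS z by (rule subgroup.mem_carrier)
    have "commutator G v z \<in> ?Z" if v: "v \<in> ?V" for v
    proof -
      have "inv v \<otimes> inv z \<otimes> inv (inv v) \<in> ?Z"
        using v z VP ZS PG by (intro Z_conj) (auto simp: subgroup.m_inv_closed)
      then have "(inv v \<otimes> inv z \<otimes> inv (inv v)) \<otimes> z \<in> ?Z" using z ZS by (simp add: subgroup.m_closed)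
      then show ?thesis using v zc by (simp add: commutator_def)
    qed
    then have "z <# ?C \<in> p_core p (G Mod ?C)"
      using Zcomm z by (intro p_stable_normal[OF stable p_core_normal pV zc ZS]) auto
    then show "z \<in> L" by (rule L(4)[OF zc])
  qed
  have "p_subgroup p ?C G"
    by (rule p_subgroup_mono[OF p pV normal_imp_subgroup[OF C] constrained])
  then obtain m where "card ?C = p ^ m" by (auto simp: p_subgroup_def)
  then have "\<exists>n. card L = p ^ n" using L(2) by (metis power_add)
  then have "L \<subseteq> ?V"
    using LS by (intro normal_p_subgroup_in_p_core[OF L(1)]) (simp add: p_subgroup_def)
  then have ZV: "?Z \<subseteq> ?V" using ZL by blast
  have "?V \<inter> E \<lhd> G"
  proof (rule normal_invI)
    show "subgroup (?V \<inter> E) G" by (rule subgroups_Inter_pair[OF V.subgroup_axioms E(1)])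
    show "g \<otimes> x \<otimes> inv g \<in> ?V \<inter> E" if "g \<in> carrier G" "x \<in> ?V \<inter> E" for g x
      using that V.inv_op_closed2[of g x] VP closed[of x g] by blast
  qed
  then have "?V \<inter> E \<inter> ?Z \<lhd> G"
    using normal_meets_center_J_o[OF p odd fin stable P E closed] by blast
  moreover have "?V \<inter> E \<inter> ?Z = ?Z" using ZV ZE by blast
  ultimately show ?thesis by simp
qed

section \<open>Exponent p: the three Thompson subgroups coincide\<close>

text \<open>The products \<open>h (s [^] i)\<close> with \<open>h \<in> \<langle>S\<rangle>\<close> and \<open>i < p\<close> already form a subgroup.\<close>

lemma (in group) card_generate_insert_le:
  assumes fin: "finite (carrier G)" and p: "p > 0"
    and S: "S \<subseteq> carrier G" and s: "s \<in> carrier G" and exp: "s [^] p = \<one>"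
    and comm: "\<And>x y. x \<in> insert s S \<Longrightarrow> y \<in> insert s S \<Longrightarrow> x \<otimes> y = y \<otimes> x"
  shows "card (generate G (insert s S)) \<le> p * card (generate G S)"
proof -
  let ?H = "generate G S"
  have HS: "subgroup ?H G" by (rule generate_is_subgroup[OF S])
  have Hc: "h \<in> carrier G" if "h \<in> ?H" for h using HS that by (rule subgroup.mem_carrier)
  have sub: "insert s S \<subseteq> carrier G" using S s by simp
  define K where "K = generate G (insert s S)"
  have HK: "?H \<subseteq> K" unfolding K_def by (rule mono_generate) blast
  have sK: "s \<in> K" unfolding K_def by (auto intro: generate.incl)
  have comm_K: "x \<otimes> y = y \<otimes> x" if "x \<in> K" "y \<in> K" for x y
    using generate_commute[OF sub sub comm] that unfolding K_def by blast
  have KS: "subgroup K G" unfolding K_def by (rule generate_is_subgroup[OF sub])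
  define f where "f = (\<lambda>(h, i::nat). h \<otimes> s [^] i)"
  let ?R = "f ` (?H \<times> {..<p})"
  have in_R: "h \<otimes> s [^] i \<in> ?R" if h: "h \<in> ?H" for h and i :: nat
  proof -
    have "s [^] i = s [^] (p * (i div p) + i mod p)" by simp
    also have "\<dots> = s [^] (p * (i div p)) \<otimes> s [^] (i mod p)"
      using s by (simp only: nat_pow_mult)
    also have "\<dots> = s [^] (i mod p)" using s exp by (simp flip: nat_pow_pow)
    finally have "h \<otimes> s [^] i = f (h, i mod p)" by (simp add: f_def)
    then show ?thesis using h p by auto
  qed
  have pow_K: "s [^] i \<in> K" for i :: nat
    using subgroup.m_closed[OF KS _ sK] subgroup.one_closed[OF KS] by (induction i) auto
  have "subgroup ?R G"
  proof (rule subgroupI)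
    show "?R \<subseteq> carrier G" using Hc s by (auto simp: f_def)
    show "?R \<noteq> {}" using in_R[OF subgroup.one_closed[OF HS]] by blast
    show "inv u \<in> ?R" if "u \<in> ?R" for u
    proof -
      from that obtain h i where hi: "h \<in> ?H" "i < p" "u = h \<otimes> s [^] i" by (auto simp: f_def)
      have "u \<otimes> (inv h \<otimes> s [^] (p - i)) = \<one>"
      proof -
        have "u \<otimes> (inv h \<otimes> s [^] (p - i)) = h \<otimes> (s [^] i \<otimes> inv h) \<otimes> s [^] (p - i)"
          using hi Hc s by (simp add: m_assoc)
        also have "s [^] i \<otimes> inv h = inv h \<otimes> s [^] i"
          using hi HK subgroup.m_inv_closed[OF HS] by (intro comm_K pow_K) auto
        also have "h \<otimes> (inv h \<otimes> s [^] i) \<otimes> s [^] (p - i) = s [^] (i + (p - i))"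
          using hi Hc s by (simp add: cancel_inv_left nat_pow_mult)
        also have "\<dots> = \<one>" using hi exp by simp
        finally show ?thesis .
      qed
      then have "inv u = inv h \<otimes> s [^] (p - i)"
        using hi Hc s by (metis inv_closed inv_inv inv_equality m_closed nat_pow_closed)
      then show ?thesis using in_R subgroup.m_inv_closed[OF HS hi(1)] by simp
    qed
    show "u \<otimes> v \<in> ?R" if uv: "u \<in> ?R" "v \<in> ?R" for u v
    proof -
      from uv(1) obtain h i where hi: "h \<in> ?H" "i < p" "u = h \<otimes> s [^] i"
        by (auto simp: f_def)
      from uv(2) obtain k j where kj: "k \<in> ?H" "j < p" "v = k \<otimes> s [^] j"
        by (auto simp: f_def)
      have "u \<otimes> v = h \<otimes> (s [^] i \<otimes> k) \<otimes> s [^] j" using hi kj Hc s by (simp add: m_assoc)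
      also have "s [^] i \<otimes> k = k \<otimes> s [^] i" using kj HK by (intro comm_K pow_K) auto
      also have "h \<otimes> (k \<otimes> s [^] i) \<otimes> s [^] j = (h \<otimes> k) \<otimes> s [^] (i + j)"
        using hi kj Hc s by (simp add: m_assoc nat_pow_mult)
      finally show ?thesis using in_R subgroup.m_closed[OF HS hi(1) kj(1)] by simp
    qed
  qed
  moreover have "insert s S \<subseteq> ?R"
  proof
    fix x assume "x \<in> insert s S"
    then consider "x = s" | "x \<in> S" by blast
    then show "x \<in> ?R"
    proof cases
      case 1
      then show ?thesis using in_R[OF subgroup.one_closed[OF HS], of 1] s by simp
    next
      case 2
      then show ?thesis using in_R[OF generate.incl[OF 2], of 0] S by auto
    qed
  qed
  ultimately have "K \<subseteq> ?R" unfolding K_def by (intro generate_subgroup_incl)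
  moreover have finH: "finite ?H" using generate_incl[OF S] fin finite_subset by blast
  ultimately have "card K \<le> card ?R" by (intro card_mono) auto
  also have "\<dots> \<le> card (?H \<times> {..<p})" using finH by (intro card_image_le) simp
  finally show ?thesis by (simp add: K_def card_cartesian_product mult.commute)
qed

text \<open>The existence of an independent generating subset, together with the upper bound for arbitrary
generating sets, computes the rank of an elementary abelian group. A generator outside the subgroup
generated so far multiplies the order by a power of \<open>p\<close> which exceeds \<open>1\<close> and is at most \<open>p\<close>.\<close>

lemma (in group) independent_generators:
  assumes p: "Factorial_Ring.prime p" and fin: "finite (carrier G)" and A: "p_subgroup p A G"
    and Acomm: "\<And>x y. x \<in> A \<Longrightarrow> y \<in> A \<Longrightarrow> x \<otimes> y = y \<otimes> x"
    and exp: "\<And>x. x \<in> A \<Longrightarrow> x [^] p = \<one>"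
    and S: "finite S" "S \<subseteq> A"
  shows "card (generate G S) \<le> p ^ card S \<and>
    (\<exists>S0 \<subseteq> S. generate G S0 = generate G S \<and> card (generate G S) = p ^ card S0)"
  using S
proof (induction S rule: finite_induct)
  case empty
  then show ?case by (simp add: generate_empty)
next
  case (insert s S)
  have AG: "subgroup A G" using A by (simp add: p_subgroup_def)
  have Ac: "A \<subseteq> carrier G" by (rule subgroup.subset[OF AG])
  have p0: "p > 0" using p by (rule prime_gt_0_nat)
  have le: "card (generate G (insert s S)) \<le> p * card (generate G S)"
    using insert.prems Ac by (intro card_generate_insert_le[OF fin p0] exp Acomm) auto
  obtain S0 where S0: "S0 \<subseteq> S" "generate G S0 = generate G S" "card (generate G S) = p ^ card S0"
    and bound: "card (generate G S) \<le> p ^ card S"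
    using insert by auto
  have "p * card (generate G S) \<le> p ^ card (insert s S)" using bound insert.hyps by simp
  with le have 1: "card (generate G (insert s S)) \<le> p ^ card (insert s S)" by linarith
  have subG: "insert s S \<subseteq> carrier G" using insert.prems Ac by blast
  let ?K = "generate G (insert s S)"
  have KS: "subgroup ?K G" by (rule generate_is_subgroup[OF subG])
  have finK: "finite ?K" using generate_incl[OF subG] fin finite_subset by blast
  have "\<exists>S0 \<subseteq> insert s S. generate G S0 = ?K \<and> card ?K = p ^ card S0"
  proof (cases "s \<in> generate G S")
    case True
    have "insert s S \<subseteq> generate G S" using True by (auto intro: generate.incl)
    then have "?K \<subseteq> generate G S"
      using subG by (intro generate_subgroup_incl generate_is_subgroup) auto
    moreover have "generate G S \<subseteq> ?K" by (rule mono_generate) blast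
    ultimately show ?thesis using S0 by (intro exI[of _ S0]) auto
  next
    case False
    have gen: "generate G (insert s S0) = ?K"
    proof
      show "generate G (insert s S0) \<subseteq> ?K" using S0(1) by (intro mono_generate) blast
      have "S \<subseteq> generate G S0" unfolding S0(2) by (auto intro: generate.incl)
      also have "\<dots> \<subseteq> generate G (insert s S0)" by (rule mono_generate) blast
      finally have "insert s S \<subseteq> generate G (insert s S0)" by (auto intro: generate.incl)
      then show "?K \<subseteq> generate G (insert s S0)"
        using subG S0(1) by (intro generate_subgroup_incl generate_is_subgroup) auto
    qed
    have "p_subgroup p ?K G"
      using generate_subgroup_incl[OF insert.prems AG] by (intro p_subgroup_mono[OF p A KS])
    then obtain n where n: "card ?K = p ^ n" by (auto simp: p_subgroup_def)
    have "generate G S \<subset> ?K"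
      using False mono_generate[of S "insert s S"] generate.incl[of s "insert s S" G] by blast
    then have "p ^ card S0 < p ^ n" using psubset_card_mono[OF finK] S0(3) n by metis
    then have "card S0 < n" using p prime_gt_1_nat power_less_imp_less_exp by blast
    moreover have "n \<le> Suc (card S0)"
    proof -
      have "p ^ n \<le> p ^ Suc (card S0)" using le S0(3) n by simp
      then show ?thesis using p prime_gt_1_nat power_le_imp_le_exp by blast
    qed
    moreover have "s \<notin> S0" "finite S0"
      using insert.hyps S0(1) finite_subset by auto
    ultimately have "n = card (insert s S0)" by simp
    then show ?thesis using gen n S0(1) by (intro exI[of _ "insert s S0"]) auto
  qed
  with 1 show ?case by blast
qed

lemma (in group) card_eq_power_rank:
  assumes p: "Factorial_Ring.prime p" and fin: "finite (carrier G)" and A: "p_subgroup p A G"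
    and Acomm: "\<And>x y. x \<in> A \<Longrightarrow> y \<in> A \<Longrightarrow> x \<otimes> y = y \<otimes> x"
    and exp: "\<And>x. x \<in> A \<Longrightarrow> x [^] p = \<one>"
  shows "card A = p ^ rank_of G A"
proof -
  have AG: "subgroup A G" using A by (simp add: p_subgroup_def)
  have finA: "finite A" using subgroup.subset[OF AG] fin by (rule finite_subset)
  have genA: "generate G A = A"
    using generate_subgroup_incl[OF _ AG] by (auto intro: generate.incl)
  have ind: "card (generate G S) \<le> p ^ card S \<and>
      (\<exists>S0 \<subseteq> S. generate G S0 = generate G S \<and> card (generate G S) = p ^ card S0)"
    if "finite S" "S \<subseteq> A" for S
    by (rule independent_generators[OF p fin A Acomm exp that])
  obtain S0 where S0: "S0 \<subseteq> A" "generate G S0 = A" "card A = p ^ card S0"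
    using ind[OF finA order_refl] genA by auto
  have "rank_of G A = card S0"
    unfolding rank_of_def
  proof (rule Least_equality)
    show "\<exists>S\<subseteq>A. finite S \<and> card S = card S0 \<and> generate G S = A"
      using S0(1,2) finite_subset[OF S0(1) finA] by (intro exI[of _ S0] conjI) simp_all
    show "card S0 \<le> n" if "\<exists>S\<subseteq>A. finite S \<and> card S = n \<and> generate G S = A" for n
    proof -
      from that obtain S where S: "S \<subseteq> A" "finite S" "card S = n" "generate G S = A" by blast
      then have "p ^ card S0 \<le> p ^ n" using ind[OF S(2,1)] S0 by simp
      then show ?thesis using p prime_gt_1_nat power_le_imp_le_exp by blast
    qed
  qed
  then show ?thesis using S0(3) by simp
qed

lemma (in group) thompson_subgroups_coincide:
  assumes p: "Factorial_Ring.prime p" and fin: "finite (carrier G)" and E: "p_subgroup p E G"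
    and exp: "\<And>x. x \<in> E \<Longrightarrow> x [^] p = \<one>"
  shows "J_r G E = J_o G E" and "J_e p G E = J_o G E"
proof -
  let ?S = "abelian_subgroups G E"
  have finS: "finite ?S" by (rule finite_abelian_subgroups[OF fin])
  have card_rank: "card A = p ^ rank_of G A" if A: "A \<in> ?S" for A
  proof -
    have A': "subgroup A G" "A \<subseteq> E" "\<And>x y. x \<in> A \<Longrightarrow> y \<in> A \<Longrightarrow> x \<otimes> y = y \<otimes> x"
      using A by (auto simp: abelian_subgroups_iff)
    have "x [^] p = \<one>" if "x \<in> A" for x using that A'(2) exp by blast
    from card_eq_power_rank[OF p fin p_subgroup_mono[OF p E A'(1,2)] A'(3) this]
    show ?thesis by blast
  qed
  have "rank_of G A = d_r G E \<longleftrightarrow> A \<in> largest_abelian G E" if A: "A \<in> ?S" for A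
  proof -
    have "rank_of G A = d_r G E \<longleftrightarrow> (\<forall>A' \<in> ?S. rank_of G A' \<le> rank_of G A)"
      unfolding d_r_def using finS A by (auto intro!: antisym Max_ge Max.boundedI)
    also have "\<dots> \<longleftrightarrow> (\<forall>A' \<in> ?S. card A' \<le> card A)"
      using card_rank A prime_gt_1_nat[OF p] by simp
    also have "\<dots> \<longleftrightarrow> A \<in> largest_abelian G E" using A by (simp add: largest_abelian_iff[OF fin])
    finally show ?thesis .
  qed
  then have "{A \<in> ?S. rank_of G A = d_r G E} = largest_abelian G E"
    by (auto simp: largest_abelian_def)
  then show "J_r G E = J_o G E" by (simp add: J_r_def J_o_eq_generate)
  have "\<forall>x \<in> A. x [^] p = \<one>" if "A \<in> ?S" for A
    using that exp unfolding abelian_subgroups_def by blast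
  then have "elementary_abelian_subgroups p G E = ?S"
    by (auto simp: elementary_abelian_subgroups_def)
  then show "J_e p G E = J_o G E" by (simp add: J_e_def J_o_def d_e_def d_o_def)
qed

text \<open>The order of the group witnesses that the \<open>LEAST\<close> in the definition is attained.\<close>

lemma (in group) exponent_annihilates:
  assumes "finite (carrier G)" "H \<subseteq> carrier G" "x \<in> H"
  shows "x [^] exponent_of G H = \<one>"
proof -
  have "order G > 0" using assms(1) order_gt_0_iff_finite by simp
  moreover have "\<forall>x \<in> H. x [^] order G = \<one>" using assms(2) pow_order_eq_1 by blast
  ultimately have "order G > 0 \<and> (\<forall>x \<in> H. x [^] order G = \<one>)" by simp
  then have "exponent_of G H > 0 \<and> (\<forall>x \<in> H. x [^] exponent_of G H = \<one>)"
    unfolding exponent_of_def by (rule LeastI)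
  then show ?thesis using assms(3) by blast
qed

lemma (in group) strongly_closedD:
  assumes "strongly_closed D P G" "D \<subseteq> carrier G" "x \<in> D" "g \<in> carrier G"
    and "g \<otimes> x \<otimes> inv g \<in> P"
  shows "g \<otimes> x \<otimes> inv g \<in> D"
proof -
  have conj: "inv (inv g) <# {x} #> inv g = {g \<otimes> x \<otimes> inv g}"
    using assms by (auto simp: l_coset_def r_coset_def)
  have "\<forall>U g. U \<subseteq> D \<longrightarrow> g \<in> carrier G \<longrightarrow> inv g <# U #> g \<subseteq> P \<longrightarrow> inv g <# U #> g \<subseteq> D"
    using assms(1) unfolding strongly_closed_def by (elim conjE)
  from this[rule_format, of "{x}" "inv g"] show ?thesis
    using assms(3-5) unfolding conj by simp
qed

theorem corollary3:
  fixes G :: "('a, 'b) monoid_scheme" and p :: nat and P D :: "'a set"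
  assumes "Factorial_Ring.prime p" and "odd p"
    and "group G" and "finite (carrier G)"
    and "p_stable p G"
    and "sylow_subgroup p P G"
    and "centralizer G (p_core p G) \<subseteq> p_core p G"
    and "subgroup D G" and "strongly_closed D P G"
    and "exponent_of G (Omega p G D) = p"
  shows "center_of G (J_o G (Omega p G D)) \<lhd> G
       \<and> center_of G (J_r G (Omega p G D)) \<lhd> G
       \<and> center_of G (J_e p G (Omega p G D)) \<lhd> G"
proof -
  interpret group G by (rule assms(3))
  let ?E = "Omega p G D"
  note p = assms(1) and fin = assms(4) and P = assms(6)
  have Dc: "D \<subseteq> carrier G" by (rule subgroup.subset[OF assms(8)])
  have DP: "D \<subseteq> P" using assms(9) by (simp add: strongly_closed_def)
  have ES: "subgroup ?E G" unfolding Omega_def using Dc by (intro generate_is_subgroup) blast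
  have ED: "?E \<subseteq> D" unfolding Omega_def by (intro generate_subgroup_incl[OF _ assms(8)]) blast
  then have EP: "?E \<subseteq> P" using DP by blast
  have pE: "p_subgroup p ?E G"
    using p_subgroup_mono[OF p _ ES EP] P sylow_subgroup_iff[OF p fin] by blast
  have exp: "x [^]\<^bsub>G\<^esub> p = \<one>\<^bsub>G\<^esub>" if "x \<in> ?E" for x
    using exponent_annihilates[OF fin subgroup.subset[OF ES] that] assms(10) by simp
  have closed: "g \<otimes>\<^bsub>G\<^esub> x \<otimes>\<^bsub>G\<^esub> inv\<^bsub>G\<^esub> g \<in> ?E"
    if x: "x \<in> ?E" and g: "g \<in> carrier G" and "g \<otimes>\<^bsub>G\<^esub> x \<otimes>\<^bsub>G\<^esub> inv\<^bsub>G\<^esub> g \<in> P" for x g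
  proof -
    let ?y = "g \<otimes>\<^bsub>G\<^esub> x \<otimes>\<^bsub>G\<^esub> inv\<^bsub>G\<^esub> g"
    have xc: "x \<in> carrier G" using ES x by (rule subgroup.mem_carrier)
    have "?y \<in> D" using strongly_closedD[OF assms(9) Dc _ g that(3)] ED x by blast
    moreover have "?y [^]\<^bsub>G\<^esub> p = g \<otimes>\<^bsub>G\<^esub> x [^]\<^bsub>G\<^esub> p \<otimes>\<^bsub>G\<^esub> inv\<^bsub>G\<^esub> g"
      by (rule group_hom.hom_nat_pow[OF conj_hom[OF g] xc, symmetric])
    ultimately show ?thesis
      unfolding Omega_def using exp[OF x] g by (intro generate.incl) simp
  qed
  have "center_of G (J_o G ?E) \<lhd> G"
    by (rule center_J_o_normal[OF p assms(2) fin assms(5) P assms(7) ES EP closed])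
  then show ?thesis using thompson_subgroups_coincide[OF p fin pE exp] by simp
qed

end
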